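(* Let $n\ge2$ and let $f:\overline{\mathbb B}^n_0\to\mathbb R^n$ be a locally quasiconformal embedding. Then $f$ does not admit cavitation at the origin if and only if $$\lim_{r\to0^+}\operatorname{mod} f(\mathcal A(r,1))=+\infty .$$
   Context: Notation: $\mathbb B^n_0=\{x\in\mathbb R^n:0<|x|<1\}$; $\overline{\mathbb B}^n_0=\{0<|x|\le1\}$; $\mathcal A(r,R)=\{x\in\mathbb R^n: r<|x|<R\}$; $S_r=\{|x|=r\}$; $m_n$ is Lebesgue measure; $\overline{\mathbb R}^n=\mathbb R^n\cup\{\infty\}$; $\omega_{n-1}$ is the area of the unit sphere $\mathbb S^{n-1}$. Quasiconformality: a homeomorphism $f:G\to G'$ between domains of $\mathbb R^n$ is $K$-quasiconformal if $f$ is absolutely continuous on lines (ACL) in $G$ and $K_f(x)=\|f'(x)\|^n/J_f(x)\le K$ for a.e. $x\in G$, where $J_f$ is the Jacobian determinant and $\|f'(x)\|=\max_{|h|=1}|f'(x)h|$; it is quasiconformal if this holds for some $K<\infty$. A locally quasiconformal embedding $f$ of $\overline{\mathbb B}^n_0$ into $\mathbb R^n$ is an embedding that extends to a domain $G\not\ni0$ containing $\overline{\mathbb B}^n_0$ in such a way that $f$ is quasiconformal on $\{x\in G:|x|>\varepsilon\}$ for each $\varepsilon\in(0,1)$. Standing assumptions: $f$ is orientation-preserving, and for $0<r_1<r_2<1$ the surface $f(S_{r_1})$ lies inside $f(S_{r_2})$, i.e. in the bounded component of $\mathbb R^n\setminus f(S_{r_2})$. Cavitation: $f$ admits cavitation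 at the origin if the bounded connected component of $\mathbb R^n\setminus f(\mathbb B^n_0)$ is a non-degenerate continuum (a compact connected set with more than one point). Modulus: for a family $\Gamma$ of curves in $\mathbb R^n$, $\mathrm{adm}(\Gamma)$ is the set of Borel functions $\varrho\ge0$ on $\mathbb R^n$, finite a.e., with $\int_\gamma\varrho\,|dx|\ge1$ for every locally rectifiable $\gamma\in\Gamma$, and $\mathsf M(\Gamma)=\inf_{\varrho\in \mathrm{adm}(\Gamma)}\int_{\mathbb R^n}\varrho^n\,dm_n$. A ring is a domain $\mathcal R=\overline{\mathbb R}^n\setminus(C_0\cup C_1)$ with $C_0,C_1$ disjoint continua whose complements in $\overline{\mathbb R}^n$ are connected; its modulus is $\operatorname{mod}\mathcal R=[\omega_{n-1}/\mathsf M(\Gamma_{\mathcal R})]^{1/(n-1)}$, where $\Gamma_{\mathcal R}$ is the family of all curves joining $C_0$ and $C_1$ in $\mathcal R$. *)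

theory Defs
  imports "HOL-Analysis.Analysis"
begin

definition domain :: "'a::topological_space set \<Rightarrow> bool" where
  "domain G \<longleftrightarrow> open G \<and> connected G \<and> G \<noteq> {}"

definition punctured_ball :: "'a::real_normed_vector set" where
  "punctured_ball = {x. 0 < norm x \<and> norm x < 1}"

definition punctured_cball :: "'a::real_normed_vector set" where
  "punctured_cball = {x. 0 < norm x \<and> norm x \<le> 1}"

definition spherical_ring :: "real \<Rightarrow> real \<Rightarrow> 'a::real_normed_vector set" where
  "spherical_ring r R = {x. r < norm x \<and> norm x < R}"

definition absolutely_continuous_on :: "real set \<Rightarrow> (real \<Rightarrow> 'a::real_normed_vector) \<Rightarrow> bool" where
  "absolutely_continuous_on I g \<longleftrightarrow>
     (\<forall>\<epsilon>>0. \<exists>\<delta>>0. \<forall>D S. D division_of S \<and> S \<subseteq> I \<and> (\<Sum>k\<in>D. measure lborel k) < \<delta> \<longrightarrow>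
        (\<Sum>k\<in>D. norm (g (Sup k) - g (Inf k))) < \<epsilon>)"

text \<open>
  For every closed box in \<open>G\<close> and every coordinate direction \<open>i\<close>, the map is absolutely continuous on
  almost every segment of the box parallel to the \<open>i\<close>-th axis. The segments are indexed by the
  remaining \<open>n - 1\<close> coordinates \<open>y\<close>, which carry \<open>(n - 1)\<close>-dimensional Lebesgue measure.
\<close>
definition ACL_on :: "(real^'n) set \<Rightarrow> (real^'n \<Rightarrow> real^'n) \<Rightarrow> bool" where
  "ACL_on G f \<longleftrightarrow> continuous_on G f \<and>
     (\<forall>a b i. cbox a b \<subseteq> G \<longrightarrow>
        (AE y in Pi\<^sub>M (UNIV - {i}) (\<lambda>_. lborel).
           (\<forall>j\<in>UNIV - {i}. y j \<in> {a $ j..b $ j}) \<longrightarrow>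
           absolutely_continuous_on {a $ i..b $ i} (\<lambda>t. f (\<chi> j. if j = i then t else y j))))"

definition jacobian :: "(real^'n \<Rightarrow> real^'n) \<Rightarrow> real^'n \<Rightarrow> real" where
  "jacobian f x = det (matrix (frechet_derivative f (at x)))"

text \<open>
  The quotient needs a convention where the Jacobian is not positive: the dilatation is \<open>1\<close> where the
  derivative vanishes and \<open>\<infinity>\<close> otherwise. In particular bounded dilatation excludes points with
  negative Jacobian, where the bare quotient would be negative.
\<close>
definition dilatation :: "(real^'n \<Rightarrow> real^'n) \<Rightarrow> real^'n \<Rightarrow> ereal" where
  "dilatation f x =
     (if jacobian f x > 0
      then ereal (onorm (frechet_derivative f (at x)) ^ CARD('n) / jacobian f x)
      else if onorm (frechet_derivative f (at x)) = 0 then 1 else \<infinity>)"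

definition K_quasiconformal ::
  "real \<Rightarrow> (real^'n) set \<Rightarrow> (real^'n) set \<Rightarrow> (real^'n \<Rightarrow> real^'n) \<Rightarrow> bool" where
  "K_quasiconformal K G G' f \<longleftrightarrow>
     domain G \<and> domain G' \<and> (\<exists>g. homeomorphism G G' f g) \<and> ACL_on G f \<and>
     (AE x in lebesgue. x \<in> G \<longrightarrow> f differentiable (at x) \<and> dilatation f x \<le> ereal K)"

definition quasiconformal :: "(real^'n) set \<Rightarrow> (real^'n) set \<Rightarrow> (real^'n \<Rightarrow> real^'n) \<Rightarrow> bool" where
  "quasiconformal G G' f \<longleftrightarrow> (\<exists>K. K_quasiconformal K G G' f)"

definition locally_quasiconformal_embedding :: "(real^'n \<Rightarrow> real^'n) \<Rightarrow> bool" where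
  "locally_quasiconformal_embedding f \<longleftrightarrow>
     (\<exists>g. homeomorphism punctured_cball (f ` punctured_cball) f g) \<and>
     (\<exists>G F. domain G \<and> 0 \<notin> G \<and> punctured_cball \<subseteq> G \<and> (\<forall>x\<in>punctured_cball. F x = f x) \<and>
        (\<forall>\<epsilon>\<in>{0<..<1}. quasiconformal {x\<in>G. norm x > \<epsilon>} (F ` {x\<in>G. norm x > \<epsilon>}) F))"

text \<open>Orientation of an almost everywhere differentiable embedding is given by the sign of its Jacobian.\<close>
definition orientation_preserving_on :: "(real^'n) set \<Rightarrow> (real^'n \<Rightarrow> real^'n) \<Rightarrow> bool" where
  "orientation_preserving_on G f \<longleftrightarrow>
     (AE x in lebesgue. x \<in> G \<longrightarrow> f differentiable (at x) \<and> jacobian f x > 0)"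

definition nested_spheres :: "(real^'n \<Rightarrow> real^'n) \<Rightarrow> bool" where
  "nested_spheres f \<longleftrightarrow>
     (\<forall>r1 r2. 0 < r1 \<and> r1 < r2 \<and> r2 < 1 \<longrightarrow> f ` sphere 0 r1 \<subseteq> inside (f ` sphere 0 r2))"

definition admits_cavitation :: "(real^'n \<Rightarrow> real^'n) \<Rightarrow> bool" where
  "admits_cavitation f \<longleftrightarrow>
     (\<exists>C \<in> components (- f ` punctured_ball).
        bounded C \<and> compact C \<and> connected C \<and> (\<exists>x\<in>C. \<exists>y\<in>C. x \<noteq> y))"

text \<open>
  Curves are parametrised over the unit interval. For such curves, having a compact parameter
  interval, local rectifiability is rectifiability.
\<close>
definition curve_length :: "(real \<Rightarrow> 'a::real_normed_vector) \<Rightarrow> real \<Rightarrow> real \<Rightarrow> ennreal" where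
  "curve_length \<gamma> a b =
     (SUP D\<in>{D. D division_of {a..b}}. ennreal (\<Sum>k\<in>D. norm (\<gamma> (Sup k) - \<gamma> (Inf k))))"

definition rectifiable :: "(real \<Rightarrow> 'a::real_normed_vector) \<Rightarrow> bool" where
  "rectifiable \<gamma> \<longleftrightarrow> path \<gamma> \<and> curve_length \<gamma> 0 1 < \<infinity>"

text \<open>
  The choice of \<open>t\<close> is immaterial: a curve is constant on any interval over which its length does not
  increase.
\<close>
definition arclength_param :: "(real \<Rightarrow> 'a::real_normed_vector) \<Rightarrow> real \<Rightarrow> 'a" where
  "arclength_param \<gamma> s = \<gamma> (SOME t. t \<in> {0..1} \<and> curve_length \<gamma> 0 t = ennreal s)"

definition line_integral :: "(real \<Rightarrow> 'a::real_normed_vector) \<Rightarrow> ('a \<Rightarrow> ennreal) \<Rightarrow> ennreal" where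
  "line_integral \<gamma> \<rho> =
     (\<integral>\<^sup>+s\<in>{0..enn2real (curve_length \<gamma> 0 1)}. \<rho> (arclength_param \<gamma> s) \<partial>lborel)"

definition admissible :: "(real \<Rightarrow> real^'n) set \<Rightarrow> (real^'n \<Rightarrow> ennreal) set" where
  "admissible \<Gamma> = {\<rho> \<in> borel_measurable borel.
     (AE x in lborel. \<rho> x < \<infinity>) \<and> (\<forall>\<gamma>\<in>\<Gamma>. rectifiable \<gamma> \<longrightarrow> line_integral \<gamma> \<rho> \<ge> 1)}"

definition modulus :: "(real \<Rightarrow> real^'n) set \<Rightarrow> ennreal" where
  "modulus \<Gamma> = (INF \<rho>\<in>admissible \<Gamma>. \<integral>\<^sup>+x. \<rho> x ^ CARD('n) \<partial>lborel)"

text \<open>The extended space is the Alexandroff compactification of \<open>\<real>\<^sup>n\<close>, with \<open>None\<close> as the point at infinity.\<close>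
abbreviation ext_space :: "(real^'n) option topology" where
  "ext_space \<equiv> Alexandroff_compactification euclidean"

definition continuum_in :: "'a topology \<Rightarrow> 'a set \<Rightarrow> bool" where
  "continuum_in X C \<longleftrightarrow> compactin X C \<and> connectedin X C \<and> C \<noteq> {}"

definition is_ring :: "(real^'n) option set \<Rightarrow> (real^'n) option set \<Rightarrow> (real^'n) option set \<Rightarrow> bool" where
  "is_ring R C0 C1 \<longleftrightarrow>
     R = UNIV - (C0 \<union> C1) \<and> openin ext_space R \<and> connectedin ext_space R \<and> R \<noteq> {} \<and>
     continuum_in ext_space C0 \<and> continuum_in ext_space C1 \<and> C0 \<inter> C1 = {} \<and>
     connectedin ext_space (- C0) \<and> connectedin ext_space (- C1)"

text \<open>
  The sets \<open>C0\<close> and \<open>C1\<close> of a ring are the two components of its complement, so they are determined by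
  the ring up to exchange. Curves join them in \<open>R\<close> if they run in \<open>R\<close> except for their endpoints.
\<close>
definition ring_curves :: "(real^'n) option set \<Rightarrow> (real \<Rightarrow> real^'n) set" where
  "ring_curves R = {\<gamma>. path \<gamma> \<and> (\<exists>C0 C1. is_ring R C0 C1 \<and>
     Some (pathstart \<gamma>) \<in> C0 \<and> Some (pathfinish \<gamma>) \<in> C1 \<and> (\<forall>t\<in>{0<..<1}. Some (\<gamma> t) \<in> R))}"

text \<open>The area of the unit sphere in \<open>\<real>\<^sup>n\<close> is \<open>n\<close> times the volume of the unit ball.\<close>
definition sphere_area :: "nat \<Rightarrow> real" where
  "sphere_area n = real n * unit_ball_vol (real n)"

text \<open>A curve family of modulus zero gives a ring of infinite modulus, one of infinite modulus gives zero.\<close>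
definition ring_modulus :: "(real^'n) option set \<Rightarrow> ereal" where
  "ring_modulus R =
     (let M = modulus (ring_curves R) in
      if M = 0 then \<infinity>
      else if M = \<infinity> then 0
      else ereal ((sphere_area CARD('n) / enn2real M) powr (1 / (real CARD('n) - 1))))"

end

theory Submission
  imports Defs
begin

text \<open>
  Let \<open>U\<close> be the union of the interiors of the surfaces \<open>f(S\<^sub>r)\<close>, \<open>r < 1\<close>, and let \<open>C\<close> be the
  intersection of the filled surfaces. By Jordan--Brouwer and a clopen argument, \<open>C\<close> is the bounded
  component of the complement of the image, and \<open>f(\<A>(r,1))\<close> is the ring that separates the filled
  surface of \<open>f(S\<^sub>r)\<close> from the complement of \<open>U\<close>.

  If \<open>C\<close> is a point, the filled surfaces shrink to it, and a test function spread over \<open>N\<close> dyadic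
  annuli shows that the modulus of the joining curves is \<open>O(N\<^sup>1\<^sup>-\<^sup>n)\<close>. If \<open>C\<close> has two points, some
  coordinate takes an interval of values on \<open>C\<close>. In each hyperplane over this interval the segments
  from a point of \<open>C\<close> to points outside \<open>U\<close> force a lower bound on the integral of \<open>\<rho>\<^sup>n\<close>, since in
  dimension \<open>n - 1 < n\<close> a point has positive \<open>n\<close>-capacity; integrating over the interval bounds the
  modulus below, uniformly in \<open>r\<close>.
\<close>

section \<open>Nested images of spheres\<close>

text \<open>The lower bound must not depend on \<open>r\<close>, although the family of joining
  curves does. Hence the curves are cut from segments between \<open>C\<close> and the complement of
  \<open>U\<close>, two sets that do not change with \<open>r\<close>. Slicing is forced: in
  dimension \<open>n\<close> the weight that balances Young's inequality along segments from one
  point would be \<open>s powr -1\<close>, which is not integrable at 0, and this failure is what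
  makes the upper bound possible when \<open>C\<close> is a point. In a hyperplane the exponent is
  \<open>-(n - 1)/n\<close>, which is integrable, and the extent of \<open>C\<close> in the
  remaining coordinate keeps the set of useful hyperplanes from being null. On the topological side,
  the input about components is that every component of the complement of a topological sphere has
  the whole sphere as its frontier. The position of one surface relative to another then follows
  from sets that are at once compact and open. The surface of radius 1 needs a separate limit
  argument, because nesting is given only below that radius.\<close>

lemma connected_sphere_Un_components:
  fixes S :: "'a::euclidean_space set"
  assumes S: "S homeomorphic sphere (a::'a) r" and r: "0 < r" and dim: "2 \<le> DIM('a)"
    and T: "\<T> \<subseteq> components (- S)"
  shows "connected (S \<union> \<Union>\<T>)"
proof -
  have conS: "connected S"
    using S connected_sphere[OF dim] homeomorphic_connectedness by blast
  have "S \<noteq> {}"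
    using S r by (metis homeomorphic_empty(2) less_le_not_le sphere_eq_empty)
  \<comment> \<open>The closures all contain \<open>S\<close>, which glues them together. The family
    is left arbitrary because it will consist of the bounded components, of the unbounded ones, or
    of all components but one.\<close>
  have cl: "closure C = C \<union> S" if "C \<in> \<T>" for C
  proof -
    have "frontier C = S"
      using Jordan_Brouwer_frontier[OF S _ dim] that T by blast
    then show ?thesis
      by (metis closure_Un_frontier)
  qed
  have "connected (\<Union>(insert S (closure ` \<T>)))"
  proof (rule connected_Union)
    show "connected s" if "s \<in> insert S (closure ` \<T>)" for s
      using that conS T connected_imp_connected_closure in_components_connected by blast
    show "\<Inter>(insert S (closure ` \<T>)) \<noteq> {}"
      using cl \<open>S \<noteq> {}\<close> by auto
  qed
  moreover have "\<Union>(insert S (closure ` \<T>)) = S \<union> \<Union>\<T>"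
    using cl by auto
  ultimately show ?thesis by simp
qed

lemma Union_filtered_components:
  "\<Union>{C \<in> components S. P C} = {x \<in> S. P (connected_component_set S x)}"
proof -
  have "\<Union>{C \<in> components S. P C} =
      (\<Union>x\<in>{x \<in> S. P (connected_component_set S x)}. connected_component_set S x)"
    by (auto simp: components_def)
  also have "\<dots> = {x \<in> S. P (connected_component_set S x)}"
  proof (intro equalityI subsetI)
    fix y assume "y \<in> (\<Union>x\<in>{x \<in> S. P (connected_component_set S x)}. connected_component_set S x)"
    then obtain x where x: "x \<in> S" "P (connected_component_set S x)" "connected_component S x y"
      by auto
    then have "connected_component_set S x = connected_component_set S y"
      using connected_component_eq[of y S x] by auto
    then show "y \<in> {x \<in> S. P (connected_component_set S x)}"
      using x connected_component_in by fastforce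
  next
    fix y assume "y \<in> {x \<in> S. P (connected_component_set S x)}"
    then show "y \<in> (\<Union>x\<in>{x \<in> S. P (connected_component_set S x)}. connected_component_set S x)"
      using connected_component_refl[of y S] by blast
  qed
  finally show ?thesis .
qed

lemma inside_eq_Union_components:
  "inside S = \<Union>{C \<in> components (- S). bounded C}"
  unfolding Union_filtered_components by (auto simp: inside_def)

lemma connected_subset_inside:
  assumes "connected T" "T \<inter> S = {}" "T \<inter> inside S \<noteq> {}"
  shows "T \<subseteq> inside S"
proof
  fix y assume "y \<in> T"
  obtain x where "x \<in> T" "x \<in> inside S" using assms by auto
  moreover have "connected_component (- S) x y"
    using assms \<open>x \<in> T\<close> \<open>y \<in> T\<close> by (auto simp: connected_component_def intro!: exI[of _ T])
  ultimately show "y \<in> inside S" using inside_same_component by blast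
qed

text \<open>This is the clopen argument in the form used below: Euclidean space is connected and not
  compact. A set with both an open and a compact description must vanish.\<close>

lemma compact_open_empty:
  fixes X :: "'a::euclidean_space set"
  assumes "compact X" "open X"
  shows "X = {}"
  using assms clopen compact_imp_closed not_compact_UNIV by metis

text \<open>\<open>cont\<close> and \<open>inj\<close> include the sphere of radius 1, whereas
  \<open>nested\<close> stops below it; the position of \<open>shell {1}\<close> has to be derived
  by continuity.\<close>

locale nested_sphere_embedding =
  fixes f :: "'a::euclidean_space \<Rightarrow> 'a"
  assumes dim: "2 \<le> DIM('a)"
    and cont: "continuous_on punctured_cball f"
    and inj: "inj_on f punctured_cball"
    and nested: "\<And>r s. 0 < r \<Longrightarrow> r < s \<Longrightarrow> s < 1 \<Longrightarrow> f ` sphere 0 r \<subseteq> inside (f ` sphere 0 s)"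
begin

text \<open>Indexing by a set of radii makes spheres, open annuli and closed annuli instances of one
  notion, so that set operations on images reduce to operations on subsets of the line.\<close>

definition shell :: "real set \<Rightarrow> 'a set" where
  "shell I = f ` {x. norm x \<in> I}"

definition core :: "real \<Rightarrow> 'a set" where
  "core r = inside (shell {r})"

definition filled :: "real \<Rightarrow> 'a set" where
  "filled r = core r \<union> shell {r}"

text \<open>The set \<open>U\<close> of the overview. The open sets \<open>core r\<close> make its
  openness immediate; connectedness will come from writing it as a union of the sets
  \<open>filled r\<close>.\<close>

definition interior_domain :: "'a set" where
  "interior_domain = (\<Union>r\<in>{0<..<1}. core r)"

text \<open>The set \<open>C\<close> of the overview, presented as the intersection of a chain of
  nonempty continua.\<close>

definition cavity :: "'a set" where
  "cavity = (\<Inter>r\<in>{0<..<1}. filled r)"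

section \<open>Images of spheres and annuli\<close>

lemma shell_sphere: "shell {r} = f ` sphere 0 r"
  by (auto simp: shell_def)

lemma shell_Un: "shell (I \<union> J) = shell I \<union> shell J"
  by (auto simp: shell_def)

lemma shell_Int:
  assumes "I \<subseteq> {0<..1}" "J \<subseteq> {0<..1}"
  shows "shell I \<inter> shell J = shell (I \<inter> J)"
proof -
  have "{x. norm x \<in> I} \<subseteq> punctured_cball" "{x. norm x \<in> J} \<subseteq> punctured_cball"
    using assms by (auto simp: punctured_cball_def)
  then have "f ` ({x. norm x \<in> I} \<inter> {x. norm x \<in> J}) = shell I \<inter> shell J"
    unfolding shell_def by (rule inj_on_image_Int[OF inj])
  then show ?thesis by (simp add: shell_def Collect_conj_eq)
qed

lemma shell_disjoint:
  assumes "I \<subseteq> {0<..1}" "J \<subseteq> {0<..1}" "I \<inter> J = {}"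
  shows "shell I \<inter> shell J = {}"
  using shell_Int[OF assms(1,2)] assms(3) by (simp add: shell_def)

lemma shell_ne: "I \<noteq> {} \<Longrightarrow> I \<subseteq> {0..} \<Longrightarrow> shell I \<noteq> {}"
proof -
  assume "I \<noteq> {}" "I \<subseteq> {0..}"
  then obtain r where "r \<in> I" "0 \<le> r" by auto
  then obtain x :: 'a where "norm x = r" using vector_choose_size by blast
  then show ?thesis using \<open>r \<in> I\<close> by (auto simp: shell_def)
qed

lemma cont_shell: "I \<subseteq> {0<..1} \<Longrightarrow> continuous_on {x. norm x \<in> I} f"
  by (rule continuous_on_subset[OF cont]) (auto simp: punctured_cball_def)

lemma open_shell:
  assumes "I \<subseteq> {0<..1}" "open I"
  shows "open (shell I)"
  unfolding shell_def
proof (rule invariance_of_domain)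
  show "continuous_on {x. norm x \<in> I} f" using cont_shell assms by blast
  have "open (norm -` I :: 'a set)"
    by (rule open_vimage[OF assms(2)]) (intro continuous_intros)
  then show "open {x::'a. norm x \<in> I}" by (simp add: vimage_def)
  show "inj_on f {x. norm x \<in> I}"
    using assms by (intro inj_on_subset[OF inj]) (auto simp: punctured_cball_def)
qed

lemma compact_shell:
  assumes "I \<subseteq> {0<..1}" "compact I"
  shows "compact (shell I)"
  unfolding shell_def
proof (rule compact_continuous_image)
  show "continuous_on {x. norm x \<in> I} f" using cont_shell assms by blast
  have "closed (norm -` I :: 'a set)"
    using assms(2) compact_imp_closed by (intro closed_vimage) (auto intro!: continuous_intros)
  moreover have "bounded (norm -` I :: 'a set)"
    using assms(1) by (auto simp: bounded_iff intro!: exI[of _ 1])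
  ultimately show "compact {x::'a. norm x \<in> I}"
    by (simp add: compact_eq_bounded_closed vimage_def)
qed

lemma connected_shell_open: "0 \<le> r \<Longrightarrow> s \<le> 1 \<Longrightarrow> connected (shell {r<..<s})"
  unfolding shell_def
  using connected_annulus(1)[OF dim, of r 0 s]
  by (intro connected_continuous_image cont_shell) auto

lemma connected_shell_sphere: "0 < r \<Longrightarrow> r \<le> 1 \<Longrightarrow> connected (shell {r})"
  unfolding shell_sphere
  using connected_sphere[OF dim]
  by (intro connected_continuous_image continuous_on_subset[OF cont])
     (auto simp: punctured_cball_def)

lemma shell_homeomorphic:
  assumes "0 < r" "r \<le> 1"
  shows "shell {r} homeomorphic sphere (0::'a) r"
proof -
  have "sphere (0::'a) r homeomorphic shell {r}"
    unfolding shell_sphere using assms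
    by (intro homeomorphic_compact[OF _ continuous_on_subset[OF cont] _ inj_on_subset[OF inj]])
       (auto simp: punctured_cball_def)
  then show ?thesis using homeomorphic_sym by blast
qed

lemma closed_shell_sphere: "0 < r \<Longrightarrow> r \<le> 1 \<Longrightarrow> closed (shell {r})"
  by (intro compact_imp_closed compact_shell) auto

lemma open_core: "0 < r \<Longrightarrow> r \<le> 1 \<Longrightarrow> open (core r)"
  unfolding core_def by (intro open_inside closed_shell_sphere)

lemma core_shell: "core r \<inter> shell {r} = {}"
  unfolding core_def by (simp add: inside_no_overlap)

text \<open>In this form the filled surface is visibly closed, since the outside of a compact set is
  open.\<close>

lemma filled_eq: "filled r = - outside (shell {r})"
  using union_with_inside[of "shell {r}"] by (auto simp: filled_def core_def)

lemma compact_filled: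
  assumes "0 < r" "r \<le> 1"
  shows "compact (filled r)"
proof -
  have "compact (shell {r})" using assms by (intro compact_shell) auto
  then have "bounded (filled r)" "closed (filled r)"
    by (auto simp: filled_def core_def bounded_inside compact_imp_bounded)
       (auto simp: filled_eq[unfolded filled_def core_def] open_outside compact_imp_closed)
  then show ?thesis by (simp add: compact_eq_bounded_closed)
qed

lemma connected_filled:
  assumes "0 < r" "r \<le> 1"
  shows "connected (filled r)"
proof -
  have "connected (shell {r} \<union> \<Union>{C \<in> components (- shell {r}). bounded C})"
    using shell_homeomorphic[OF assms] assms dim
    by (intro connected_sphere_Un_components) auto
  then show ?thesis
    by (simp add: filled_def core_def inside_eq_Union_components Un_commute)
qed

section \<open>Order of the nested surfaces\<close>

lemma shell_core: "0 < r \<Longrightarrow> r < s \<Longrightarrow> s < 1 \<Longrightarrow> shell {r} \<subseteq> core s"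
  using nested by (simp add: shell_sphere core_def)

text \<open>If the two sets met, each surface would lie in the core of the other. The union of the
  two cores would then equal the union of the two filled surfaces, and so be open, compact and
  nonempty.\<close>

lemma core_disjoint_shell:
  assumes "0 < r" "r < t" "t < 1"
  shows "shell {t} \<inter> core r = {}"
proof (rule ccontr)
  assume ne: "shell {t} \<inter> core r \<noteq> {}"
  have "shell {t} \<inter> shell {r} = {}" using assms by (intro shell_disjoint) auto
  then have tr: "shell {t} \<subseteq> core r"
    using ne assms connected_subset_inside[OF connected_shell_sphere[of t]]
    unfolding core_def by auto
  have rt: "shell {r} \<subseteq> core t" using shell_core assms by auto
  have "core r \<union> core t = filled r \<union> filled t"
    using tr rt by (auto simp: filled_def)
  then have "compact (core r \<union> core t)"
    using compact_filled assms by (simp add: compact_Un)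
  moreover have "open (core r \<union> core t)" using open_core assms by (simp add: open_Un)
  ultimately have "core r \<union> core t = {}" using compact_open_empty by blast
  then show False using tr shell_ne[of "{t}"] assms by auto
qed

lemma connected_Compl_core:
  assumes "0 < r" "r \<le> 1"
  shows "connected (- core r)"
proof -
  let ?T = "{C \<in> components (- shell {r}). \<not> bounded C}"
  have "connected (shell {r} \<union> \<Union>?T)"
    using shell_homeomorphic[OF assms] assms dim
    by (intro connected_sphere_Un_components) auto
  moreover have "- core r = shell {r} \<union> \<Union>?T"
    unfolding core_def inside_def Union_filtered_components by auto
  ultimately show ?thesis by simp
qed

text \<open>Otherwise the connected set \<open>- core s\<close>, which avoids
  \<open>shell {r}\<close>, would lie in \<open>core r\<close>, and two compact filled surfaces
  would cover the whole space.\<close>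

lemma filled_subset_core:
  assumes "0 < r" "r < s" "s < 1"
  shows "filled r \<subseteq> core s"
proof -
  have rs: "shell {r} \<subseteq> core s" using shell_core assms by auto
  have "core r \<subseteq> core s"
  proof (rule ccontr)
    assume ne: "\<not> core r \<subseteq> core s"
    have "- core s \<subseteq> inside (shell {r})"
    proof (rule connected_subset_inside)
      show "connected (- core s)" using connected_Compl_core assms by auto
      show "- core s \<inter> shell {r} = {}" using rs by auto
      show "- core s \<inter> inside (shell {r}) \<noteq> {}" using ne by (auto simp: core_def)
    qed
    then have "UNIV = filled s \<union> filled r" by (auto simp: filled_def core_def)
    then have "compact (UNIV :: 'a set)" using compact_filled assms compact_Un
      by (metis less_eq_real_def order.strict_trans)
    then show False by simp
  qed
  then show ?thesis using rs by (auto simp: filled_def)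
qed

lemma filled_mono:
  assumes "0 < r" "r \<le> s" "s < 1"
  shows "filled r \<subseteq> filled s"
  using filled_subset_core[of r s] assms by (cases "r = s") (auto simp: filled_def)

lemma shell_interval_core:
  assumes "0 < r" "r < s" "s < 1"
  shows "shell {r<..<s} \<subseteq> core s - filled r"
proof
  fix p assume "p \<in> shell {r<..<s}"
  then obtain t where t: "r < t" "t < s" "p \<in> shell {t}" by (auto simp: shell_def)
  have "p \<in> core s" using shell_core[of t s] t assms by auto
  moreover have "p \<notin> core r" using core_disjoint_shell[of r t] t assms by auto
  moreover have "p \<notin> shell {r}"
    using shell_disjoint[of "{t}" "{r}"] t assms by auto
  ultimately show "p \<in> core s - filled r" by (auto simp: filled_def)
qed

lemma core_diff_filled:
  assumes "0 < r" "r < s" "s < 1"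
  shows "core s - filled r = shell {r<..<s}"
proof -
  \<comment> \<open>Both expressions denote the set of hypothetical points between the two surfaces
    that are missed by the image. \<open>?X\<close> is open. \<open>?Y\<close> is compact because it
    removes an open shell; widening the interval to \<open>r/2\<close> and \<open>(s+1)/2\<close>
    changes nothing, as the extra pieces lie in \<open>core r\<close> or outside
    \<open>filled s\<close>.\<close>
  let ?X = "core s - (filled r \<union> shell {r..s})"
  let ?Y = "filled s - (core r \<union> shell {r/2<..<(s+1)/2})"
  have sub1: "shell {r<..<s} \<subseteq> core s - filled r" using shell_interval_core assms .
  have split: "shell {r..s} = shell {r} \<union> shell {r<..<s} \<union> shell {s}"
  proof -
    have "{r..s} = {r} \<union> {r<..<s} \<union> {s}" using assms by auto
    then show ?thesis by (simp only: shell_Un)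
  qed
  have split2: "shell {r/2<..<(s+1)/2} = shell {r/2<..<r} \<union> shell {r..s} \<union> shell {s<..<(s+1)/2}"
  proof -
    have "{r/2<..<(s+1)/2} = {r/2<..<r} \<union> {r..s} \<union> {s<..<(s+1)/2}" using assms by auto
    then show ?thesis by (simp only: shell_Un)
  qed
  have XY: "?X = ?Y"
  proof -
    have 1: "shell {r/2<..<r} \<subseteq> core r"
      using shell_interval_core[of "r/2" r] assms by auto
    have 2: "shell {s<..<(s+1)/2} \<inter> filled s = {}"
      using shell_interval_core[of s "(s+1)/2"] assms by auto
    have 3: "shell {s} \<inter> core s = {}" using core_shell by blast
    show ?thesis unfolding split2 split using 1 2 3 by (auto simp: filled_def)
  qed
  have "compact (shell {r..s})" using assms by (intro compact_shell) auto
  then have op: "open ?X"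
    using assms compact_filled[of r] open_core[of s]
    by (intro open_Diff closed_Un) (auto simp: compact_imp_closed)
  have "open (shell {r/2<..<(s+1)/2})" using assms by (intro open_shell) auto
  then have "compact ?Y"
    using assms compact_filled[of s] open_core[of r] by (intro compact_diff open_Un) auto
  then have "?X = {}" using op compact_open_empty XY by metis
  then show ?thesis using sub1 split core_shell[of s] by (auto simp: filled_def)
qed

section \<open>The limit domain and the cavity\<close>

lemma interior_domain_diff_filled:
  assumes "0 < r" "r < 1"
  shows "interior_domain - filled r = shell {r<..<1}"
proof
  show "interior_domain - filled r \<subseteq> shell {r<..<1}"
  proof
    fix p assume p: "p \<in> interior_domain - filled r"
    then obtain s where s: "0 < s" "s < 1" "p \<in> core s" by (auto simp: interior_domain_def)
    then have "r < s" using p filled_mono[of s r] assms by (force simp: filled_def)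
    then have "p \<in> shell {r<..<s}" using core_diff_filled[of r s] assms s p by auto
    then show "p \<in> shell {r<..<1}" using s by (auto simp: shell_def)
  qed
  show "shell {r<..<1} \<subseteq> interior_domain - filled r"
  proof
    fix p assume "p \<in> shell {r<..<1}"
    then obtain t where t: "r < t" "t < 1" "p \<in> shell {t}" by (auto simp: shell_def)
    have "p \<in> shell {r<..<(t+1)/2}"
      using t by (auto simp: shell_def)
    then have "p \<in> core ((t+1)/2) - filled r"
      using core_diff_filled[of r "(t+1)/2"] assms t by auto
    then show "p \<in> interior_domain - filled r"
      using assms t by (auto simp: interior_domain_def intro!: bexI[of _ "(t+1)/2"])
  qed
qed

lemma filled_subset_interior_domain:
  assumes "0 < r" "r < 1"
  shows "filled r \<subseteq> interior_domain"
proof -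
  have "filled r \<subseteq> core ((r+1)/2)" using assms by (intro filled_subset_core) auto
  moreover have "(r+1)/2 \<in> {0<..<1}" using assms by auto
  ultimately show ?thesis unfolding interior_domain_def by blast
qed

lemma cavity_subset: "0 < r \<Longrightarrow> r < 1 \<Longrightarrow> cavity \<subseteq> filled r"
  by (auto simp: cavity_def)

lemma interior_domain_split:
  assumes "0 < r" "r < 1"
  shows "interior_domain = filled r \<union> shell {r<..<1}"
  using interior_domain_diff_filled filled_subset_interior_domain assms by blast

lemma filled_chain:
  assumes "S \<in> filled ` {0<..<1} \<and> T \<in> filled ` {0<..<1}"
  shows "S \<subseteq> T \<or> T \<subseteq> S"
proof -
  obtain r s where "r \<in> {0<..<1}" "s \<in> {0<..<1}" "S = filled r" "T = filled s" using assms by auto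
  then show ?thesis using filled_mono[of r s] filled_mono[of s r] by (cases "r \<le> s") auto
qed

lemma cavity_ne: "cavity \<noteq> {}"
  unfolding cavity_def
proof (rule compact_chain)
  show "{} \<notin> filled ` {0<..<1}"
  proof
    assume "{} \<in> filled ` {0<..<1}"
    then obtain r where "0 < r" "filled r = {}" by auto
    then show False using shell_ne[of "{r}"] by (auto simp: filled_def)
  qed
next
  show "S \<subseteq> T \<or> T \<subseteq> S" if "S \<in> filled ` {0<..<1} \<and> T \<in> filled ` {0<..<1}" for S T
    using filled_chain that by blast
qed (use compact_filled in auto)

lemma compact_cavity: "compact cavity"
  unfolding cavity_def by (rule compact_Inter) (use compact_filled in auto)

lemma connected_cavity: "connected cavity"
  unfolding cavity_def
proof (rule connected_chain)
  show "S \<subseteq> T \<or> T \<subseteq> S" if "S \<in> filled ` {0<..<1} \<and> T \<in> filled ` {0<..<1}" for S T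
    using filled_chain that by blast
qed (use compact_filled connected_filled in auto)

lemma open_interior_domain: "open interior_domain"
  unfolding interior_domain_def using open_core by auto

lemma connected_interior_domain: "connected interior_domain"
proof -
  have "interior_domain = \<Union>(filled ` {0<..<1})"
  proof
    show "interior_domain \<subseteq> \<Union>(filled ` {0<..<1})"
      unfolding interior_domain_def by (rule UN_mono) (auto simp: filled_def)
    show "\<Union>(filled ` {0<..<1}) \<subseteq> interior_domain"
      by (intro UN_least filled_subset_interior_domain) auto
  qed
  moreover have "connected (\<Union>(filled ` {0<..<1}))"
  proof (rule connected_Union)
    show "\<Inter>(filled ` {0<..<1}) \<noteq> {}" using cavity_ne by (simp add: cavity_def)
  qed (use connected_filled in auto)
  ultimately show ?thesis by simp
qed

text \<open>A point \<open>f x\<close> with \<open>norm x = 1\<close> in the open set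
  \<open>core s\<close> would have nearby points \<open>f (t *\<^sub>R x)\<close>,
  \<open>s < t < 1\<close>, in \<open>core s\<close> as well, against the order of the
  surfaces.\<close>

lemma interior_domain_disjoint: "interior_domain \<inter> shell {1} = {}"
proof (rule ccontr)
  assume "interior_domain \<inter> shell {1} \<noteq> {}"
  then obtain p where "p \<in> interior_domain" "p \<in> shell {1}" by blast
  then obtain s x where s: "0 < s" "s < 1" and x: "norm x = 1" "f x \<in> core s"
    unfolding interior_domain_def shell_def by auto
  define h where "h t = f (t *\<^sub>R x)" for t
  have sub: "(\<lambda>t. t *\<^sub>R x) ` {s..1} \<subseteq> punctured_cball"
    using s x by (auto simp: punctured_cball_def)
  have "continuous_on {s..1} h"
    unfolding h_def
    by (rule continuous_on_compose2[OF cont _ sub]) (intro continuous_intros)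
  then have "(h \<longlongrightarrow> h 1) (at_left 1)"
    using s by (simp add: continuous_on_Icc_at_leftD)
  moreover have "open (core s)" "h 1 \<in> core s" using s x open_core[of s] by (simp_all add: h_def)
  ultimately have "\<forall>\<^sub>F t in at_left 1. h t \<in> core s"
    by (rule topological_tendstoD)
  then obtain b where b: "b < 1" "\<And>t. b < t \<Longrightarrow> t < 1 \<Longrightarrow> h t \<in> core s"
    unfolding eventually_at_left_field by blast
  define t where "t = (max b s + 1) / 2"
  have t: "b < t" "s < t" "t < 1" using b s by (auto simp: t_def)
  have "h t \<in> shell {t}" using t s x unfolding h_def shell_def by auto
  then show False using core_disjoint_shell[of s t] b(2)[of t] t s by blast
qed

text \<open>Up to any inner radius the domain is already compact, so new limit points can only arise
  from the outer annulus, whose closed version adds \<open>shell {1}\<close>.\<close>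

lemma closure_interior_domain: "closure interior_domain \<subseteq> interior_domain \<union> shell {1}"
proof -
  have half: "{1/2..1} = {1/2} \<union> {1/2<..<1} \<union> {1::real}" by auto
  have sh: "shell {1/2..1} = shell {1/2} \<union> shell {1/2<..<1} \<union> shell {1}"
    unfolding half shell_Un by simp
  have dom: "interior_domain = filled (1/2) \<union> shell {1/2<..<1}"
    by (rule interior_domain_split) auto
  have "closed (filled (1/2) \<union> shell {1/2..1})"
    by (intro compact_imp_closed compact_Un compact_filled compact_shell) auto
  moreover have "interior_domain \<subseteq> filled (1/2) \<union> shell {1/2..1}"
    unfolding dom sh by blast
  ultimately have "closure interior_domain \<subseteq> filled (1/2) \<union> shell {1/2..1}"
    by (rule closure_minimal[rotated])
  also have "\<dots> \<subseteq> interior_domain \<union> shell {1}"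
    unfolding dom sh filled_def by blast
  finally show ?thesis .
qed

lemma bounded_interior_domain: "bounded interior_domain"
proof -
  have "interior_domain \<subseteq> filled (1/2) \<union> shell {1/2..1}"
    using interior_domain_split[of "1/2"] by (auto simp: shell_def)
  moreover have "compact (filled (1/2) \<union> shell {1/2..1})"
    by (intro compact_Un compact_filled compact_shell) auto
  ultimately show ?thesis using bounded_subset compact_imp_bounded by blast
qed

text \<open>The domain is open, connected and gains only points of \<open>shell {1}\<close> in its
  closure, so no larger connected set avoids that surface. As a consequence its complement is
  \<open>shell {1}\<close> with all other components attached, hence connected.\<close>

lemma interior_domain_component: "interior_domain \<in> components (- shell {1})"
  unfolding in_components_maximal
proof (intro conjI allI impI)
  show "interior_domain \<noteq> {}"
    using cavity_ne cavity_subset[of "1/2"] filled_subset_interior_domain[of "1/2"] by auto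
  show "interior_domain \<subseteq> - shell {1}" using interior_domain_disjoint by blast
  show "connected interior_domain" by (rule connected_interior_domain)
  fix D assume D: "D \<noteq> {} \<and> interior_domain \<subseteq> D \<and> D \<subseteq> - shell {1} \<and> connected D"
  have sub: "D \<subseteq> interior_domain \<union> - closure interior_domain"
    using D closure_interior_domain by blast
  have "interior_domain \<inter> D = {} \<or> - closure interior_domain \<inter> D = {}"
    using D closure_subset[of interior_domain]
    by (intro connectedD[OF _ open_interior_domain _ _ sub]) auto
  then show "D = interior_domain"
    using D sub \<open>interior_domain \<noteq> {}\<close> by blast
qed

lemma connected_Compl_interior_domain: "connected (- interior_domain)"
proof -
  let ?T = "components (- shell {1}) - {interior_domain}"
  have "connected (shell {1} \<union> \<Union>?T)"
    using shell_homeomorphic[of 1] dim by (intro connected_sphere_Un_components) auto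
  moreover have "- interior_domain = shell {1} \<union> \<Union>?T"
  proof -
    have disj: "X \<inter> interior_domain = {}" if "X \<in> ?T" for X
      using that interior_domain_component components_nonoverlap by blast
    have "x \<in> shell {1} \<union> \<Union>?T" if x: "x \<notin> interior_domain" for x
    proof (cases "x \<in> shell {1}")
      case False
      then have "x \<in> \<Union>(components (- shell {1}))" by (simp add: Union_components)
      then show ?thesis using x by blast
    qed auto
    then show ?thesis using disj interior_domain_disjoint by fast
  qed
  ultimately show ?thesis by simp
qed

lemma unbounded_Compl_interior_domain: "\<not> bounded (- interior_domain)"
  using bounded_interior_domain cobounded_imp_unbounded[of "- interior_domain"] by auto

lemma Compl_punctured_ball: "- f ` punctured_ball = cavity \<union> - interior_domain"
  and cavity_subset_interior_domain: "cavity \<subseteq> interior_domain"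
proof -
  have B: "f ` punctured_ball = shell {0<..<1}"
    by (auto simp: shell_def punctured_ball_def)
  have "p \<notin> cavity" "p \<in> interior_domain" if p: "p \<in> shell {0<..<1}" for p
  proof -
    obtain x where "0 < norm x" "norm x < 1" "p = f x"
      using p unfolding shell_def by auto
    then obtain t where t: "0 < t" "t < 1" "p \<in> shell {t}"
      unfolding shell_def by blast
    \<comment> \<open>Any radius below \<open>t\<close> would serve: it exhibits a filled surface
      that misses \<open>p\<close>.\<close>
    then have "p \<in> shell {t/2<..<1}" using t by (auto simp: shell_def)
    then have *: "p \<in> interior_domain - filled (t/2)"
      using interior_domain_diff_filled[of "t/2"] t by auto
    then show "p \<in> interior_domain" by auto
    show "p \<notin> cavity" using * cavity_subset[of "t/2"] t by auto
  qed
  moreover have "p \<in> shell {0<..<1}" if p: "p \<in> interior_domain" "p \<notin> cavity" for p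
  proof -
    obtain r where r: "0 < r" "r < 1" "p \<notin> filled r" using p by (auto simp: cavity_def)
    then have "p \<in> shell {r<..<1}" using interior_domain_diff_filled p by blast
    then show ?thesis using r by (auto simp: shell_def)
  qed
  ultimately show "- f ` punctured_ball = cavity \<union> - interior_domain" unfolding B by blast
  show "cavity \<subseteq> interior_domain"
    using cavity_subset[of "1/2"] filled_subset_interior_domain[of "1/2"] by auto
qed

text \<open>The outer piece of the complement is connected and unbounded, so a component that meets
  it contains it and cannot be bounded.\<close>

lemma bounded_component_eq_cavity:
  assumes C: "C \<in> components (- f ` punctured_ball)" "bounded C"
  shows "C = cavity"
proof -
  have conn: "connected C" "C \<noteq> {}" and sub: "C \<subseteq> cavity \<union> - interior_domain"
    using C(1) in_components_connected in_components_nonempty in_components_subset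
    unfolding Compl_punctured_ball by blast+
  have "- interior_domain \<inter> C = {}"
  proof (rule ccontr)
    assume "- interior_domain \<inter> C \<noteq> {}"
    then have "- interior_domain \<subseteq> C"
      by (intro components_maximal[OF C(1) connected_Compl_interior_domain])
         (auto simp: Compl_punctured_ball Int_commute)
    then show False using C(2) bounded_subset unbounded_Compl_interior_domain by blast
  qed
  then have "C \<subseteq> cavity" using sub by blast
  moreover have "cavity \<subseteq> C"
    using \<open>C \<subseteq> cavity\<close> conn
    by (intro components_maximal[OF C(1) connected_cavity]) (auto simp: Compl_punctured_ball)
  ultimately show ?thesis by blast
qed

lemma cavity_component: "cavity \<in> components (- f ` punctured_ball)"
proof -
  obtain p where p: "p \<in> cavity" using cavity_ne by blast
  then have "p \<in> \<Union>(components (- f ` punctured_ball))"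
    unfolding Union_components Compl_punctured_ball by blast
  then obtain C where C: "C \<in> components (- f ` punctured_ball)" "p \<in> C"
    by blast
  have "cavity \<subseteq> C" using p C
    by (intro components_maximal[OF C(1) connected_cavity]) (auto simp: Compl_punctured_ball)
  have sub: "C \<subseteq> cavity \<union> - interior_domain"
    using C(1) in_components_subset unfolding Compl_punctured_ball by blast
  \<comment> \<open>On the complement of the image, the open sets \<open>interior_domain\<close> and
    \<open>- cavity\<close> are disjoint and cover everything, so they separate the cavity from the
    outer piece.\<close>
  have "interior_domain \<inter> C = {} \<or> - cavity \<inter> C = {}"
  proof (rule connectedD)
    show "connected C" using C in_components_connected by blast
    show "open (- cavity)" using compact_cavity by (simp add: compact_imp_closed open_Compl)
  qed (use open_interior_domain sub cavity_subset_interior_domain in auto)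
  then have "C \<subseteq> cavity" using p C cavity_subset_interior_domain by blast
  then show ?thesis using \<open>cavity \<subseteq> C\<close> C by (metis subset_antisym)
qed

text \<open>Compactness: the sets \<open>filled r - V\<close> form a chain of compact sets with
  empty intersection. This is how a one-point cavity yields surfaces of small diameter.\<close>

lemma filled_shrink:
  assumes "open V" "cavity \<subseteq> V"
  shows "\<exists>r. 0 < r \<and> r < 1 \<and> filled r \<subseteq> V"
proof (rule ccontr)
  assume neg: "\<not> ?thesis"
  have "\<Inter>((\<lambda>r. filled r - V) ` {0<..<1}) \<noteq> {}"
  proof (rule compact_chain)
    fix S assume "S \<in> (\<lambda>r. filled r - V) ` {0<..<1}"
    then show "compact S"
      using compact_filled assms by (auto simp: compact_diff)
  next
    show "{} \<notin> (\<lambda>r. filled r - V) ` {0<..<1}"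
      using neg by auto
  next
    fix S T assume "S \<in> (\<lambda>r. filled r - V) ` {0<..<1} \<and> T \<in> (\<lambda>r. filled r - V) ` {0<..<1}"
    then show "S \<subseteq> T \<or> T \<subseteq> S"
      using filled_chain by blast
  qed
  then show False using assms by (auto simp: cavity_def)
qed

end

section \<open>Length of curves\<close>

lemma division_real_cases:
  fixes k :: "real set"
  assumes "D division_of S" "k \<in> D"
  obtains x y where "k = {x..y}" "x \<le> y" "Inf k = x" "Sup k = y"
proof -
  obtain x y where k: "k = cbox x y" "k \<noteq> {}" using assms by blast
  then have "x \<le> y" by auto
  then show ?thesis using that[of x y] k by auto
qed

lemma sum_division_le_curve_length:
  assumes "D division_of {a..b}"
  shows "ennreal (\<Sum>k\<in>D. norm (\<gamma> (Sup k) - \<gamma> (Inf k))) \<le> curve_length \<gamma> a b"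
  unfolding curve_length_def using assms by (intro SUP_upper) auto

lemma norm_diff_le_curve_length:
  assumes "a \<le> b"
  shows "ennreal (norm (\<gamma> b - \<gamma> a)) \<le> curve_length \<gamma> a b"
proof -
  have "{{a..b}} division_of {a..b}"
    using division_of_self[of a b] assms by simp
  from sum_division_le_curve_length[OF this, of \<gamma>] assms show ?thesis by simp
qed

lemma division_of_interval_nonempty: "\<exists>D. D division_of {a..b::real}"
  using elementary_interval[of a b] by auto

text \<open>Clamping the endpoints keeps the index set \<open>D\<close> fixed while \<open>u\<close>
  and \<open>v\<close> vary, so the sum can be treated as a continuous function of them. The proof
  passes to the traces of the intervals on \<open>{u..v}\<close>.\<close>

lemma sum_clamped_division_le_curve_length:
  fixes \<gamma> :: "real \<Rightarrow> 'a::real_normed_vector"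
  assumes D: "D division_of {a..b}" and uv: "a \<le> u" "u \<le> v" "v \<le> b"
  shows "ennreal (\<Sum>k\<in>D. norm (\<gamma> (max u (min (Sup k) v)) - \<gamma> (max u (min (Inf k) v))))
           \<le> curve_length \<gamma> u v"
proof -
  define g where "g k = norm (\<gamma> (max u (min (Sup k) v)) - \<gamma> (max u (min (Inf k) v)))" for k
  define h where "h k = norm (\<gamma> (Sup k) - \<gamma> (Inf k))" for k
  define D' where "D' = {k \<in> D. {u..v} \<inter> k \<noteq> {}}"
  have E: "((\<inter>) {u..v} ` D') division_of {u..v}"
  proof -
    have "{cbox u v \<inter> k |k. k \<in> D \<and> cbox u v \<inter> k \<noteq> {}} division_of cbox u v"
      by (rule division_inter_1[OF D]) (use uv in auto)
    moreover have "{cbox u v \<inter> k |k. k \<in> D \<and> cbox u v \<inter> k \<noteq> {}} = (\<inter>) {u..v} ` D'"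
      by (auto simp: D'_def)
    ultimately show ?thesis by simp
  qed
  have fin: "finite D" using D by auto
  have "sum g D = sum g D'"
  proof (rule sum.mono_neutral_right)
    show "\<forall>k\<in>D - D'. g k = 0"
    proof
      fix k assume k: "k \<in> D - D'"
      then obtain x y where xy: "k = {x..y}" "x \<le> y" "Inf k = x" "Sup k = y"
        using division_real_cases[OF D] by blast
      then have "y < u \<or> v < x" using k uv by (auto simp: D'_def not_le)
      then show "g k = 0" using xy uv by (auto simp: g_def)
    qed
  qed (use fin in \<open>auto simp: D'_def\<close>)
  also have "\<dots> = sum (\<lambda>k. h ({u..v} \<inter> k)) D'"
  proof (rule sum.cong)
    fix k assume k: "k \<in> D'"
    then obtain x y where xy: "k = {x..y}" "x \<le> y" "Inf k = x" "Sup k = y"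
      using division_real_cases[OF D] by (auto simp: D'_def)
    have le: "max u x \<le> min v y" using k xy by (auto simp: D'_def)
    moreover have "{u..v} \<inter> k = {max u x..min v y}" using xy by auto
    ultimately have "Sup ({u..v} \<inter> k) = min v y" "Inf ({u..v} \<inter> k) = max u x" by auto
    moreover have "max u (min x v) = max u x" "max u (min y v) = min v y" using le uv by auto
    ultimately show "g k = h ({u..v} \<inter> k)" using xy by (simp add: g_def h_def)
  qed simp
  also have "\<dots> = sum h ((\<inter>) {u..v} ` D')"
  proof (rule sum.reindex_nontrivial[symmetric, unfolded o_def])
    show "finite D'" using fin by (simp add: D'_def)
    \<comment> \<open>Distinct members of \<open>D\<close> can have the same trace on
      \<open>{u..v}\<close>. Their interiors are disjoint, so this trace is a single point, where
      \<open>h\<close> is 0.\<close>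
    fix k l assume kl: "k \<in> D'" "l \<in> D'" "k \<noteq> l" "{u..v} \<inter> k = {u..v} \<inter> l"
    let ?K = "{u..v} \<inter> k"
    have "?K \<in> (\<inter>) {u..v} ` D'" using kl by auto
    then obtain x y where xy: "?K = {x..y}" "x \<le> y" "Inf ?K = x" "Sup ?K = y"
      using division_real_cases[OF E] by blast
    have "interior k \<inter> interior l = {}" using kl D by (auto simp: D'_def)
    moreover have "interior ?K \<subseteq> interior k \<inter> interior l"
      using kl(4) by (metis Int_greatest Int_lower2 interior_mono)
    ultimately have "{x<..<y} = {}" using xy by auto
    then have "x = y" using xy by auto
    then show "h ?K = 0" using xy by (simp add: h_def)
  qed
  finally have "sum g D = sum h ((\<inter>) {u..v} ` D')" .
  then show ?thesis
    using sum_division_le_curve_length[OF E, of \<gamma>] by (simp add: g_def h_def)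
qed

lemma curve_length_superadditive:
  fixes \<gamma> :: "real \<Rightarrow> 'a::real_normed_vector"
  assumes "a \<le> b" "b \<le> c"
  shows "curve_length \<gamma> a b + curve_length \<gamma> b c \<le> curve_length \<gamma> a c"
proof -
  let ?h = "\<lambda>k. norm (\<gamma> (Sup k) - \<gamma> (Inf k))"
  have *: "ennreal (sum ?h D) + ennreal (sum ?h E) \<le> curve_length \<gamma> a c"
    if D: "D division_of {a..b}" and E: "E division_of {b..c}" for D E
  proof -
    have "D \<union> E division_of {a..b} \<union> {b..c}"
      by (rule division_disjoint_union[OF D E]) auto
    moreover have "{a..b} \<union> {b..c} = {a..c}" using assms by auto
    ultimately have DE: "D \<union> E division_of {a..c}" by simp
    \<comment> \<open>A member common to both divisions lies in \<open>{a..b}\<close> and in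
      \<open>{b..c}\<close>, so it is the degenerate interval at \<open>b\<close>.\<close>
    have "?h k = 0" if k: "k \<in> D \<inter> E" for k
    proof -
      obtain x y where xy: "k = {x..y}" "x \<le> y" "Inf k = x" "Sup k = y"
        using division_real_cases[OF D] k by blast
      have "k \<subseteq> {a..b}" "k \<subseteq> {b..c}" using k D E by blast+
      then have "x = y" using xy by auto
      then show ?thesis using xy by simp
    qed
    then have "sum ?h (D \<union> E) = sum ?h D + sum ?h E"
      using D E by (intro sum.union_inter_neutral) auto
    then show ?thesis
      using sum_division_le_curve_length[OF DE, of \<gamma>]
      by (simp add: sum_nonneg flip: ennreal_plus)
  qed
  have ne: "{D. D division_of {u..v::real}} \<noteq> {}" for u v
    using division_of_interval_nonempty by auto
  show ?thesis
    unfolding curve_length_def[of \<gamma> a b] curve_length_def[of \<gamma> b c]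
      ennreal_SUP_add_left[OF ne, symmetric] ennreal_SUP_add_right[OF ne]
    by (intro SUP_least) (use * in auto)
qed

text \<open>Instead of refining the division at \<open>b\<close>, its endpoints are clamped to each
  half. Only an interval that contains \<open>b\<close> calls for the triangle inequality.\<close>

lemma curve_length_subadditive:
  fixes \<gamma> :: "real \<Rightarrow> 'a::real_normed_vector"
  assumes "a \<le> b" "b \<le> c"
  shows "curve_length \<gamma> a c \<le> curve_length \<gamma> a b + curve_length \<gamma> b c"
  unfolding curve_length_def[of \<gamma> a c]
proof (rule SUP_least)
  fix D assume "D \<in> {D. D division_of {a..c}}"
  then have D: "D division_of {a..c}" by simp
  let ?g = "\<lambda>u v k. norm (\<gamma> (max u (min (Sup k) v)) - \<gamma> (max u (min (Inf k) v)))"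
  have "(\<Sum>k\<in>D. norm (\<gamma> (Sup k) - \<gamma> (Inf k))) \<le> (\<Sum>k\<in>D. ?g a b k + ?g b c k)"
  proof (rule sum_mono)
    fix k assume k: "k \<in> D"
    then obtain x y where xy: "k = {x..y}" "x \<le> y" "Inf k = x" "Sup k = y"
      using division_real_cases[OF D] by blast
    have "k \<subseteq> {a..c}" using D k by blast
    then have ac: "a \<le> x" "y \<le> c" using xy by auto
    consider "y \<le> b" | "b \<le> x" | "x \<le> b" "b \<le> y" by linarith
    then show "norm (\<gamma> (Sup k) - \<gamma> (Inf k)) \<le> ?g a b k + ?g b c k"
    proof cases
      case 3
      then have "max a (min y b) = b" "max a (min x b) = x" "max b (min y c) = y" "max b (min x c) = b"
        using ac xy assms by auto
      then show ?thesis
        using norm_triangle_ineq[of "\<gamma> b - \<gamma> x" "\<gamma> y - \<gamma> b"] xy by simp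
    qed (use xy ac assms in auto)
  qed
  then have "ennreal (\<Sum>k\<in>D. norm (\<gamma> (Sup k) - \<gamma> (Inf k)))
      \<le> ennreal (\<Sum>k\<in>D. ?g a b k) + ennreal (\<Sum>k\<in>D. ?g b c k)"
    by (simp add: sum.distrib sum_nonneg flip: ennreal_plus)
  also have "\<dots> \<le> curve_length \<gamma> a b + curve_length \<gamma> b c"
    using assms by (intro add_mono sum_clamped_division_le_curve_length[OF D]) auto
  finally show "ennreal (\<Sum>k\<in>D. norm (\<gamma> (Sup k) - \<gamma> (Inf k)))
      \<le> curve_length \<gamma> a b + curve_length \<gamma> b c" .
qed

lemma curve_length_split:
  fixes \<gamma> :: "real \<Rightarrow> 'a::real_normed_vector"
  assumes "a \<le> b" "b \<le> c"
  shows "curve_length \<gamma> a c = curve_length \<gamma> a b + curve_length \<gamma> b c"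
  using curve_length_subadditive[OF assms] curve_length_superadditive[OF assms]
  by (intro antisym)

text \<open>
  For fixed \<open>D\<close>, the sum over \<open>D\<close> clamped to \<open>{u..v}\<close> is continuous in \<open>u\<close> and \<open>v\<close>, and the length is
  the supremum of these sums. Lower semicontinuity of both \<open>curve_length \<gamma> a\<close> and
  \<open>\<lambda>t. curve_length \<gamma> t b\<close>, whose sum is constant, gives continuity.
\<close>
lemma curve_length_lower_semicontinuous:
  fixes \<gamma> :: "real \<Rightarrow> 'a::real_normed_vector"
  assumes cont: "continuous_on {a..b} \<gamma>" and t: "t \<in> {a..b}"
  shows "x < curve_length \<gamma> a t \<Longrightarrow> \<forall>\<^sub>F s in at t within {a..b}. x < curve_length \<gamma> a s"
    and "x < curve_length \<gamma> t b \<Longrightarrow> \<forall>\<^sub>F s in at t within {a..b}. x < curve_length \<gamma> s b"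
proof -
  have in_ab: "\<And>s. s \<in> {a..b} \<Longrightarrow> a \<le> s \<and> s \<le> b" by auto
  assume "x < curve_length \<gamma> a t"
  then obtain D where D: "D division_of {a..t}" "x < ennreal (\<Sum>k\<in>D. norm (\<gamma> (Sup k) - \<gamma> (Inf k)))"
    unfolding curve_length_def less_SUP_iff by auto
  define G where "G s = (\<Sum>k\<in>D. norm (\<gamma> (max a (min (Sup k) s)) - \<gamma> (max a (min (Inf k) s))))" for s
  have clamp: "max a (min p s) \<in> {a..b}" if "s \<in> {a..b}" for p s using that by auto
  have "continuous_on {a..b} G"
    unfolding G_def
    by (intro continuous_intros continuous_on_compose2[OF cont]) (use clamp in auto)
  then have lim: "((\<lambda>s. ennreal (G s)) \<longlongrightarrow> ennreal (G t)) (at t within {a..b})"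
    using t by (intro tendsto_ennrealI) (auto simp: continuous_on_def)
  have "G t = (\<Sum>k\<in>D. norm (\<gamma> (Sup k) - \<gamma> (Inf k)))"
    unfolding G_def
  proof (rule sum.cong)
    fix k assume k: "k \<in> D"
    then obtain p q where pq: "k = {p..q}" "p \<le> q" "Inf k = p" "Sup k = q"
      using division_real_cases[OF D(1)] by blast
    have "k \<subseteq> {a..t}" using D k by blast
    then show "norm (\<gamma> (max a (min (Sup k) t)) - \<gamma> (max a (min (Inf k) t))) = norm (\<gamma> (Sup k) - \<gamma> (Inf k))"
      using pq by auto
  qed simp
  then have "\<forall>\<^sub>F s in at t within {a..b}. x < ennreal (G s)"
    using D(2) order_tendstoD(1)[OF lim] by simp
  moreover have "\<forall>\<^sub>F s in at t within {a..b}. s \<in> {a..b}"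
    by (simp add: eventually_at_filter)
  ultimately show "\<forall>\<^sub>F s in at t within {a..b}. x < curve_length \<gamma> a s"
  proof eventually_elim
    case (elim s)
    have "ennreal (G s) \<le> curve_length \<gamma> a s"
    proof (cases "s \<le> t")
      case True
      then show ?thesis unfolding G_def
        using elim by (intro sum_clamped_division_le_curve_length[OF D(1)]) auto
    next
      case False
      have "G s = G t"
        unfolding G_def
      proof (rule sum.cong)
        fix k assume k: "k \<in> D"
        then obtain p q where pq: "k = {p..q}" "p \<le> q" "Inf k = p" "Sup k = q"
          using division_real_cases[OF D(1)] by blast
        have "k \<subseteq> {a..t}" using D k by blast
        then have "a \<le> p" "q \<le> t" using pq by auto
        then show "norm (\<gamma> (max a (min (Sup k) s)) - \<gamma> (max a (min (Inf k) s))) =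
            norm (\<gamma> (max a (min (Sup k) t)) - \<gamma> (max a (min (Inf k) t)))"
          using pq False by (simp add: min_absorb1)
      qed simp
      also have "ennreal (G t) \<le> curve_length \<gamma> a t"
        unfolding G_def
        using t by (intro sum_clamped_division_le_curve_length[OF D(1)]) auto
      also have "\<dots> \<le> curve_length \<gamma> a s"
        using curve_length_split[of a t s \<gamma>] False t by auto
      finally show ?thesis .
    qed
    then show ?case using elim by auto
  qed
next
  assume "x < curve_length \<gamma> t b"
  then obtain D where D: "D division_of {t..b}" "x < ennreal (\<Sum>k\<in>D. norm (\<gamma> (Sup k) - \<gamma> (Inf k)))"
    unfolding curve_length_def less_SUP_iff by auto
  define G where "G s = (\<Sum>k\<in>D. norm (\<gamma> (max s (min (Sup k) b)) - \<gamma> (max s (min (Inf k) b))))" for s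
  have clamp: "max s (min p b) \<in> {a..b}" if "s \<in> {a..b}" for p s using that by auto
  have "continuous_on {a..b} G"
    unfolding G_def
    by (intro continuous_intros continuous_on_compose2[OF cont]) (use clamp in auto)
  then have lim: "((\<lambda>s. ennreal (G s)) \<longlongrightarrow> ennreal (G t)) (at t within {a..b})"
    using t by (intro tendsto_ennrealI) (auto simp: continuous_on_def)
  have "G t = (\<Sum>k\<in>D. norm (\<gamma> (Sup k) - \<gamma> (Inf k)))"
    unfolding G_def
  proof (rule sum.cong)
    fix k assume k: "k \<in> D"
    then obtain p q where pq: "k = {p..q}" "p \<le> q" "Inf k = p" "Sup k = q"
      using division_real_cases[OF D(1)] by blast
    have "k \<subseteq> {t..b}" using D k by blast
    then show "norm (\<gamma> (max t (min (Sup k) b)) - \<gamma> (max t (min (Inf k) b))) = norm (\<gamma> (Sup k) - \<gamma> (Inf k))"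
      using pq by auto
  qed simp
  then have "\<forall>\<^sub>F s in at t within {a..b}. x < ennreal (G s)"
    using D(2) order_tendstoD(1)[OF lim] by simp
  moreover have "\<forall>\<^sub>F s in at t within {a..b}. s \<in> {a..b}"
    by (simp add: eventually_at_filter)
  ultimately show "\<forall>\<^sub>F s in at t within {a..b}. x < curve_length \<gamma> s b"
  proof eventually_elim
    case (elim s)
    have "ennreal (G s) \<le> curve_length \<gamma> s b"
    proof (cases "t \<le> s")
      case True
      then show ?thesis unfolding G_def
        using elim by (intro sum_clamped_division_le_curve_length[OF D(1)]) auto
    next
      case False
      have "G s = G t"
        unfolding G_def
      proof (rule sum.cong)
        fix k assume k: "k \<in> D"
        then obtain p q where pq: "k = {p..q}" "p \<le> q" "Inf k = p" "Sup k = q"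
          using division_real_cases[OF D(1)] by blast
        have "k \<subseteq> {t..b}" using D k by blast
        then have "t \<le> p" "q \<le> b" using pq by auto
        then show "norm (\<gamma> (max s (min (Sup k) b)) - \<gamma> (max s (min (Inf k) b))) =
            norm (\<gamma> (max t (min (Sup k) b)) - \<gamma> (max t (min (Inf k) b)))"
          using pq False by (simp add: max_absorb2)
      qed simp
      also have "ennreal (G t) \<le> curve_length \<gamma> t b"
        unfolding G_def
        using t by (intro sum_clamped_division_le_curve_length[OF D(1)]) auto
      also have "\<dots> \<le> curve_length \<gamma> s b"
        using curve_length_split[of s t b \<gamma>] False t by auto
      finally show ?thesis .
    qed
    then show ?case using elim by auto
  qed
qed

lemma continuous_on_curve_length:
  fixes \<gamma> :: "real \<Rightarrow> 'a::real_normed_vector"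
  assumes cont: "continuous_on {a..b} \<gamma>" and fin: "curve_length \<gamma> a b < \<infinity>"
  shows "continuous_on {a..b} (\<lambda>t. enn2real (curve_length \<gamma> a t))"
  unfolding continuous_on_def
proof
  fix t assume t: "t \<in> {a..b}"
  define v where "v s = enn2real (curve_length \<gamma> a s)" for s
  define w where "w s = enn2real (curve_length \<gamma> s b)" for s
  define l where "l = enn2real (curve_length \<gamma> a b)"
  have vw: "curve_length \<gamma> a s = ennreal (v s)" "curve_length \<gamma> s b = ennreal (w s)"
      "0 \<le> v s" "0 \<le> w s" "v s + w s = l" if "s \<in> {a..b}" for s
  proof -
    have sum: "curve_length \<gamma> a b = curve_length \<gamma> a s + curve_length \<gamma> s b"
      using that by (intro curve_length_split) auto
    then have f: "curve_length \<gamma> a s < \<infinity>" "curve_length \<gamma> s b < \<infinity>"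
      using fin by (auto simp: less_top)
    show "curve_length \<gamma> a s = ennreal (v s)" "curve_length \<gamma> s b = ennreal (w s)"
      using f by (simp_all add: v_def w_def)
    show "0 \<le> v s" "0 \<le> w s" by (simp_all add: v_def w_def)
    show "v s + w s = l"
      unfolding v_def w_def l_def sum using f by (simp add: enn2real_plus)
  qed
  have ev: "\<forall>\<^sub>F s in at t within {a..b}. s \<in> {a..b}"
    by (simp add: eventually_at_filter)
  have "(v \<longlongrightarrow> v t) (at t within {a..b})"
  proof (rule order_tendstoI)
    fix x assume x: "x < v t"
    show "\<forall>\<^sub>F s in at t within {a..b}. x < v s"
    \<comment> \<open>\<open>ennreal\<close> sends negative numbers to 0, so a strict bound by a
      negative number does not transfer and is treated apart.\<close>
    proof (cases "x < 0")
      case True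
      show ?thesis using ev by eventually_elim (use vw True in force)
    next
      case False
      then have "ennreal x < curve_length \<gamma> a t" using vw[OF t] x by (simp add: ennreal_less_iff)
      from curve_length_lower_semicontinuous(1)[OF cont t this] ev
      show ?thesis
        by eventually_elim (use vw False in \<open>simp add: ennreal_less_iff\<close>)
    qed
  next
    fix x assume x: "v t < x"
    then have x': "l - x < w t" using vw[OF t] by linarith
    show "\<forall>\<^sub>F s in at t within {a..b}. v s < x"
    proof (cases "l - x < 0")
      case True
      show ?thesis using ev
      proof eventually_elim
        case (elim s) then show ?case using vw(4,5)[OF elim] True by linarith
      qed
    next
      case False
      then have "ennreal (l - x) < curve_length \<gamma> t b" using vw[OF t] x' by (simp add: ennreal_less_iff)
      from curve_length_lower_semicontinuous(2)[OF cont t this] ev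
      show ?thesis
      proof eventually_elim
        case (elim s)
        then have "l - x < w s" using vw(2)[OF elim(2)] False by (simp add: ennreal_less_iff)
        then show ?case using vw(5)[OF elim(2)] by linarith
      qed
    qed
  qed
  then show "((\<lambda>t. enn2real (curve_length \<gamma> a t)) \<longlongrightarrow> enn2real (curve_length \<gamma> a t)) (at t within {a..b})"
    by (simp add: v_def[abs_def])
qed

text \<open>Continuity of the length function lets the intermediate value theorem supply a witness
  for each \<open>SOME\<close>. Additivity bounds the distance between points at any two witnesses
  by the difference of the lengths, whatever the choice.\<close>

lemma arclength_param_lipschitz:
  fixes \<gamma> :: "real \<Rightarrow> 'a::real_normed_vector"
  assumes rect: "rectifiable \<gamma>"
  defines "l \<equiv> enn2real (curve_length \<gamma> 0 1)"
  shows "\<And>s s'. 0 \<le> s \<Longrightarrow> s \<le> s' \<Longrightarrow> s' \<le> l \<Longrightarrow>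
           norm (arclength_param \<gamma> s' - arclength_param \<gamma> s) \<le> s' - s"
    and "arclength_param \<gamma> 0 = \<gamma> 0" and "arclength_param \<gamma> l = \<gamma> 1"
proof -
  have cont: "continuous_on {0..1} \<gamma>" and fin: "curve_length \<gamma> 0 1 < \<infinity>"
    using rect by (auto simp: rectifiable_def path_def)
  have split: "curve_length \<gamma> 0 t' = curve_length \<gamma> 0 t + curve_length \<gamma> t t'"
    if "0 \<le> t" "t \<le> t'" for t t'
    using that by (rule curve_length_split)
  have fin': "curve_length \<gamma> 0 t < \<infinity>" if "t \<in> {0..1}" for t
    using split[of t 1] that fin by (auto simp: less_top)
  have "curve_length \<gamma> 0 0 = 0"
  proof -
    have "curve_length \<gamma> 0 0 = curve_length \<gamma> 0 0 + curve_length \<gamma> 0 0"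
      using split[of 0 0] by simp
    then show ?thesis using fin'[of 0] by (metis atLeastAtMost_iff add.right_neutral ennreal_add_left_cancel infinity_ennreal_def order.refl order.strict_iff_not zero_le_one top.not_eq_extremum)
  qed
  have ex: "\<exists>t. t \<in> {0..1} \<and> curve_length \<gamma> 0 t = ennreal s" if "0 \<le> s" "s \<le> l" for s
  proof -
    have "\<exists>t\<ge>0. t \<le> 1 \<and> enn2real (curve_length \<gamma> 0 t) = s"
      using that \<open>curve_length \<gamma> 0 0 = 0\<close>
      by (intro IVT' continuous_on_curve_length[OF cont fin]) (auto simp: l_def)
    then obtain t where t: "0 \<le> t" "t \<le> 1" "enn2real (curve_length \<gamma> 0 t) = s" by blast
    then have "curve_length \<gamma> 0 t = ennreal s" using fin'[of t] by auto
    then show ?thesis using t by auto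
  qed
  define T where "T s = (SOME t. t \<in> {0..1} \<and> curve_length \<gamma> 0 t = ennreal s)" for s
  have T: "T s \<in> {0..1}" "curve_length \<gamma> 0 (T s) = ennreal s" if "0 \<le> s" "s \<le> l" for s
    using someI_ex[OF ex[OF that]] by (auto simp: T_def)
  have aT: "arclength_param \<gamma> s = \<gamma> (T s)" for s by (simp add: arclength_param_def T_def)
  have lip: "norm (\<gamma> t' - \<gamma> t) \<le> s' - s"
    if "0 \<le> t" "t \<le> t'" "t' \<le> 1" "curve_length \<gamma> 0 t = ennreal s" "curve_length \<gamma> 0 t' = ennreal s'"
      "0 \<le> s" "0 \<le> s'" for t t' s s'
  proof -
    have "ennreal s + ennreal (norm (\<gamma> t' - \<gamma> t)) \<le> ennreal s'"
      using split[of t t'] norm_diff_le_curve_length[of t t' \<gamma>] that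
      by (metis add_left_mono)
    then show ?thesis using that by (simp flip: ennreal_plus)
  qed
  show "norm (arclength_param \<gamma> s' - arclength_param \<gamma> s) \<le> s' - s" if s: "0 \<le> s" "s \<le> s'" "s' \<le> l" for s s'
  proof (cases "T s \<le> T s'")
    case True
    then show ?thesis using lip[of "T s" "T s'" s s'] T[of s] T[of s'] s by (simp add: aT)
  next
    \<comment> \<open>The chosen parameters are not known to be monotone. In the reversed order the
      norm is at most \<open>s - s'\<close>, and this does not exceed \<open>s' - s\<close>.\<close>
    case False
    then have "norm (\<gamma> (T s) - \<gamma> (T s')) \<le> s - s'"
      using lip[of "T s'" "T s" s' s] T[of s] T[of s'] s by simp
    then have "norm (\<gamma> (T s) - \<gamma> (T s')) \<le> s' - s" using s by linarith
    then show ?thesis by (simp add: aT norm_minus_commute)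
  qed
  have "0 \<le> l" by (simp add: l_def)
  have "norm (\<gamma> (T 0) - \<gamma> 0) \<le> 0 - 0"
    using T[of 0] \<open>0 \<le> l\<close> \<open>curve_length \<gamma> 0 0 = 0\<close> by (intro lip) auto
  then show "arclength_param \<gamma> 0 = \<gamma> 0" by (simp add: aT)
  have "norm (\<gamma> 1 - \<gamma> (T l)) \<le> l - l"
    using T[of l] \<open>0 \<le> l\<close> fin by (intro lip) (auto simp: l_def)
  then show "arclength_param \<gamma> l = \<gamma> 1" by (simp add: aT)
qed

section \<open>Length and line integrals of segments\<close>

lemma curve_length_linepath:
  fixes a b :: "'a::real_normed_vector"
  assumes "0 \<le> t"
  shows "curve_length (linepath a b) 0 t = ennreal (t * norm (b - a))"
proof -
  have "ennreal (\<Sum>k\<in>D. norm (linepath a b (Sup k) - linepath a b (Inf k))) = ennreal (t * norm (b - a))"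
    if D: "D division_of {0..t}" for D
  proof -
    have "(\<Sum>k\<in>D. norm (linepath a b (Sup k) - linepath a b (Inf k))) = (\<Sum>k\<in>D. measure lborel k * norm (b - a))"
    proof (rule sum.cong)
      fix k assume "k \<in> D"
      then obtain x y where xy: "k = {x..y}" "x \<le> y" "Inf k = x" "Sup k = y"
        using division_real_cases[OF D] by blast
      have "linepath a b y - linepath a b x = (y - x) *\<^sub>R (b - a)"
        by (simp add: linepath_def algebra_simps)
      then show "norm (linepath a b (Sup k) - linepath a b (Inf k)) = measure lborel k * norm (b - a)"
        using xy by simp
    qed simp
    also have "\<dots> = t * norm (b - a)"
      using additive_content_division[of D 0 t] D assms by (simp flip: sum_distrib_right)
    finally show ?thesis by simp
  qed
  then show ?thesis
    unfolding curve_length_def using division_of_interval_nonempty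
    by (intro antisym SUP_least) (auto intro: SUP_upper2)
qed

lemma rectifiable_linepath: "rectifiable (linepath a b)"
  by (simp add: rectifiable_def curve_length_linepath)

lemma line_integral_linepath:
  fixes a b :: "'a::euclidean_space"
  assumes [measurable]: "\<rho> \<in> borel_measurable borel"
  shows "line_integral (linepath a b) \<rho> =
           ennreal (norm (b - a)) * (\<integral>\<^sup>+t\<in>{0..1}. \<rho> (linepath a b t) \<partial>lborel)"
proof (cases "a = b")
  case True
  have "(\<integral>\<^sup>+s\<in>{0..0}. \<rho> (arclength_param (linepath b b) s) \<partial>lborel) = 0"
    by (intro nn_integral_0_iff_AE[THEN iffD2] nn_integral_null_set) auto
  with True show ?thesis
    by (simp add: line_integral_def curve_length_linepath)
next
  case False
  define l where "l = norm (b - a)"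
  have l: "0 < l" using False by (simp add: l_def)
  have len: "enn2real (curve_length (linepath a b) 0 1) = l"
    by (simp add: curve_length_linepath l_def)
  have arc: "arclength_param (linepath a b) s = linepath a b (s / l)" if "s \<in> {0..l}" for s
  proof -
    have "(SOME t. t \<in> {0..1} \<and> curve_length (linepath a b) 0 t = ennreal s) = s / l"
    proof (rule some_equality)
      show "s / l \<in> {0..1} \<and> curve_length (linepath a b) 0 (s / l) = ennreal s"
        using that l by (simp add: curve_length_linepath flip: l_def)
      show "t = s / l" if "t \<in> {0..1} \<and> curve_length (linepath a b) 0 t = ennreal s" for t
      proof -
        have "ennreal (t * l) = ennreal s"
          using that curve_length_linepath[of t a b] by (simp add: l_def)
        then have "t * l = s" using that \<open>s \<in> {0..l}\<close> l by (subst (asm) ennreal_inj) auto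
        then show ?thesis using l by (simp add: field_simps)
      qed
    qed
    then show ?thesis by (simp add: arclength_param_def)
  qed
  have "line_integral (linepath a b) \<rho> = (\<integral>\<^sup>+s. \<rho> (linepath a b (s / l)) * indicator {0..l} s \<partial>lborel)"
    unfolding line_integral_def len using arc by (intro nn_integral_cong) (auto split: split_indicator)
  also have "\<dots> = \<bar>l\<bar> * (\<integral>\<^sup>+t. \<rho> (linepath a b ((0 + l * t) / l)) * indicator {0..l} (0 + l * t) \<partial>lborel)"
  proof (rule nn_integral_real_affine)
    have [measurable]: "(\<lambda>s. linepath a b (s / l)) \<in> borel_measurable borel"
      unfolding linepath_def by measurable
    show "(\<lambda>s. \<rho> (linepath a b (s / l)) * indicator {0..l} s) \<in> borel_measurable borel"
      by measurable
  qed (use l in auto)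
  also have "(\<integral>\<^sup>+t. \<rho> (linepath a b ((0 + l * t) / l)) * indicator {0..l} (0 + l * t) \<partial>lborel) =
      (\<integral>\<^sup>+t\<in>{0..1}. \<rho> (linepath a b t) \<partial>lborel)"
  proof (rule nn_integral_cong)
    fix t :: real
    have "indicator {0..l} (0 + l * t) = (indicator {0..1} t :: ennreal)"
      using l by (auto simp: indicator_def zero_le_mult_iff)
    then show "\<rho> (linepath a b ((0 + l * t) / l)) * indicator {0..l} (0 + l * t) =
        \<rho> (linepath a b t) * indicator {0..1} t"
      using l by simp
  qed
  finally show ?thesis using l by (simp add: l_def)
qed

section \<open>Crossing concentric annuli\<close>

lemma lipschitz_crossing:
  fixes h :: "real \<Rightarrow> real"
  assumes lip: "\<And>s s'. 0 \<le> s \<Longrightarrow> s \<le> s' \<Longrightarrow> s' \<le> l \<Longrightarrow> \<bar>h s' - h s\<bar> \<le> s' - s"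
    and l: "0 \<le> l" and h: "h 0 \<le> \<alpha>" "\<alpha> \<le> \<beta>" "\<beta> \<le> h l"
  obtains s1 s2 where "0 \<le> s1" "s1 \<le> s2" "s2 \<le> l" "\<beta> - \<alpha> \<le> s2 - s1"
    "\<And>s. s1 < s \<Longrightarrow> s < s2 \<Longrightarrow> \<alpha> < h s \<and> h s < \<beta>"
proof -
  have "1-lipschitz_on {0..l} h"
  proof (rule lipschitz_onI)
    fix x y assume "x \<in> {0..l}" "y \<in> {0..l}"
    then show "dist (h x) (h y) \<le> 1 * dist x y"
      using lip[of x y] lip[of y x] by (cases "x \<le> y") (auto simp: dist_real_def)
  qed simp
  then have cont: "continuous_on {0..l} h" by (rule lipschitz_on_continuous_on)
  \<comment> \<open>\<open>s2\<close> will be the first time at which \<open>h\<close> reaches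
    \<beta>, and \<open>s1\<close> the last time before it at which \<open>h\<close> is at most
    \<alpha>. Strictly between them \<open>h\<close> stays in the open interval, and the Lipschitz
    constant 1 turns the rise into a length.\<close>
  define A where "A = {s \<in> {0..l}. \<beta> \<le> h s}"
  have "closed A"
    unfolding A_def by (intro continuous_on_closed_Collect_le cont continuous_intros)
  moreover have "bounded A" by (rule bounded_subset[of "{0..l}"]) (auto simp: A_def)
  ultimately have "compact A" by (simp add: compact_eq_bounded_closed)
  moreover have "l \<in> A" using l h by (simp add: A_def)
  ultimately obtain s2 where "s2 \<in> A" "\<forall>s\<in>A. s2 \<le> s"
    using compact_attains_inf[of A] by blast
  then have s2: "0 \<le> s2" "s2 \<le> l" "\<beta> \<le> h s2"
      "\<And>s. 0 \<le> s \<Longrightarrow> s \<le> l \<Longrightarrow> \<beta> \<le> h s \<Longrightarrow> s2 \<le> s"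
    by (simp_all add: A_def)
  define B where "B = {s \<in> {0..s2}. h s \<le> \<alpha>}"
  have sub: "{0..s2} \<subseteq> {0..l}" using s2 by simp
  have "closed B"
    unfolding B_def
    by (intro continuous_on_closed_Collect_le continuous_on_subset[OF cont sub] continuous_intros)
  moreover have "bounded B" by (rule bounded_subset[of "{0..s2}"]) (auto simp: B_def)
  ultimately have "compact B" by (simp add: compact_eq_bounded_closed)
  moreover have "0 \<in> B" using s2 h by (simp add: B_def)
  ultimately obtain s1 where "s1 \<in> B" "\<forall>s\<in>B. s \<le> s1"
    using compact_attains_sup[of B] by blast
  then have s1: "0 \<le> s1" "s1 \<le> s2" "h s1 \<le> \<alpha>"
      "\<And>s. 0 \<le> s \<Longrightarrow> s \<le> s2 \<Longrightarrow> h s \<le> \<alpha> \<Longrightarrow> s \<le> s1"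
    by (simp_all add: B_def)
  show ?thesis
  proof (rule that[of s1 s2])
    show "\<beta> - \<alpha> \<le> s2 - s1" using lip[of s1 s2] s1 s2 by linarith
    show "\<alpha> < h s \<and> h s < \<beta>" if "s1 < s" "s < s2" for s
      using s1(4)[of s] s2(4)[of s] that s1(1,2) s2(1,2) by linarith
  qed (use s1 s2 in auto)
qed

text \<open>Time reversal covers curves that run inwards; a ring does not determine which of its two
  complementary continua comes first.\<close>

lemma lipschitz_crossing_either:
  fixes h :: "real \<Rightarrow> real"
  assumes lip: "\<And>s s'. 0 \<le> s \<Longrightarrow> s \<le> s' \<Longrightarrow> s' \<le> l \<Longrightarrow> \<bar>h s' - h s\<bar> \<le> s' - s"
    and l: "0 \<le> l" and ab: "\<alpha> \<le> \<beta>"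
    and ends: "h 0 \<le> \<alpha> \<and> \<beta> \<le> h l \<or> h l \<le> \<alpha> \<and> \<beta> \<le> h 0"
  obtains s1 s2 where "0 \<le> s1" "s1 \<le> s2" "s2 \<le> l" "\<beta> - \<alpha> \<le> s2 - s1"
    "\<And>s. s1 < s \<Longrightarrow> s < s2 \<Longrightarrow> \<alpha> < h s \<and> h s < \<beta>"
  using ends
proof
  assume "h 0 \<le> \<alpha> \<and> \<beta> \<le> h l"
  then show ?thesis using lipschitz_crossing[of l h \<alpha> \<beta>] lip l ab that by blast
next
  assume e: "h l \<le> \<alpha> \<and> \<beta> \<le> h 0"
  have lip': "\<bar>h (l - s') - h (l - s)\<bar> \<le> s' - s" if "0 \<le> s" "s \<le> s'" "s' \<le> l" for s s'
    using lip[of "l - s'" "l - s"] that by (simp add: abs_minus_commute)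
  have "h (l - 0) \<le> \<alpha>" "\<beta> \<le> h (l - l)" using e by simp_all
  then obtain s1 s2 where s: "0 \<le> s1" "s1 \<le> s2" "s2 \<le> l" "\<beta> - \<alpha> \<le> s2 - s1"
      "\<And>s. s1 < s \<Longrightarrow> s < s2 \<Longrightarrow> \<alpha> < h (l - s) \<and> h (l - s) < \<beta>"
    using lipschitz_crossing[where h = "\<lambda>s. h (l - s)", OF lip' l _ ab] by blast
  show ?thesis
  proof (rule that[of "l - s2" "l - s1"])
    show "\<alpha> < h s \<and> h s < \<beta>" if "l - s2 < s" "s < l - s1" for s
      using s(5)[of "l - s"] that by simp
  qed (use s in auto)
qed

text \<open>In arclength the distance to \<open>p\<close> is 1-Lipschitz, so crossing annulus
  \<open>k\<close> takes a parameter interval of length at least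
  \<open>\<beta> k - \<alpha> k\<close> on which its indicator is 1. The comparison is made term by
  term, so the order and number of crossings do not matter.\<close>

lemma line_integral_annuli_ge:
  fixes \<gamma> :: "real \<Rightarrow> 'a::real_normed_vector"
  assumes rect: "rectifiable \<gamma>"
    and c: "\<And>k. k < N \<Longrightarrow> 0 \<le> c k" and ab: "\<And>k. k < N \<Longrightarrow> \<alpha> k \<le> \<beta> k"
    and ends: "\<And>k. k < N \<Longrightarrow> norm (\<gamma> 0 - p) \<le> \<alpha> k \<and> \<beta> k \<le> norm (\<gamma> 1 - p) \<or>
       norm (\<gamma> 1 - p) \<le> \<alpha> k \<and> \<beta> k \<le> norm (\<gamma> 0 - p)"
  shows "ennreal (\<Sum>k<N. c k * (\<beta> k - \<alpha> k)) \<le>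
     line_integral \<gamma> (\<lambda>x. \<Sum>k<N. ennreal (c k) * indicator {x. \<alpha> k < norm (x - p) \<and> norm (x - p) < \<beta> k} x)"
proof -
  define l where "l = enn2real (curve_length \<gamma> 0 1)"
  define h where "h s = norm (arclength_param \<gamma> s - p)" for s
  note arc = arclength_param_lipschitz[OF rect, folded l_def]
  have lip: "\<bar>h s' - h s\<bar> \<le> s' - s" if "0 \<le> s" "s \<le> s'" "s' \<le> l" for s s'
  proof -
    have "\<bar>h s' - h s\<bar> \<le> norm (arclength_param \<gamma> s' - arclength_param \<gamma> s)"
      unfolding h_def
      using norm_triangle_ineq3[of "arclength_param \<gamma> s' - p" "arclength_param \<gamma> s - p"] by simp
    then show ?thesis using arc(1)[OF that] by linarith
  qed
  have "\<exists>s1 s2. 0 \<le> s1 \<and> s1 \<le> s2 \<and> s2 \<le> l \<and> \<beta> k - \<alpha> k \<le> s2 - s1 \<and>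
      (\<forall>s. s1 < s \<longrightarrow> s < s2 \<longrightarrow> \<alpha> k < h s \<and> h s < \<beta> k)" if "k < N" for k
  proof -
    have "0 \<le> l" by (simp add: l_def)
    moreover have "h 0 \<le> \<alpha> k \<and> \<beta> k \<le> h l \<or> h l \<le> \<alpha> k \<and> \<beta> k \<le> h 0"
      using ends[OF that] arc(2,3) by (simp add: h_def)
    ultimately show ?thesis
      using lipschitz_crossing_either[of l h "\<alpha> k" "\<beta> k"] lip ab[OF that] by metis
  qed
  then obtain s1 s2 where s: "\<And>k. k < N \<Longrightarrow> 0 \<le> s1 k \<and> s1 k \<le> s2 k \<and> s2 k \<le> l \<and> \<beta> k - \<alpha> k \<le> s2 k - s1 k \<and>
      (\<forall>s. s1 k < s \<longrightarrow> s < s2 k \<longrightarrow> \<alpha> k < h s \<and> h s < \<beta> k)"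
    by metis
  have "ennreal (\<Sum>k<N. c k * (\<beta> k - \<alpha> k)) \<le> ennreal (\<Sum>k<N. c k * (s2 k - s1 k))"
    using s c by (intro ennreal_leI sum_mono mult_left_mono) auto
  also have "\<dots> = (\<Sum>k<N. ennreal (c k) * ennreal (s2 k - s1 k))"
    using s c by (subst sum_ennreal[symmetric]) (auto simp: ennreal_mult)
  also have "\<dots> = (\<Sum>k<N. \<integral>\<^sup>+s. ennreal (c k) * indicator {s1 k<..<s2 k} s \<partial>lborel)"
    using s by (intro sum.cong) (auto simp: nn_integral_cmult_indicator)
  also have "\<dots> = (\<integral>\<^sup>+s. (\<Sum>k<N. ennreal (c k) * indicator {s1 k<..<s2 k} s) \<partial>lborel)"
    by (subst nn_integral_sum) auto
  also have "\<dots> \<le> line_integral \<gamma> (\<lambda>x. \<Sum>k<N. ennreal (c k) * indicator {x. \<alpha> k < norm (x - p) \<and> norm (x - p) < \<beta> k} x)"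
    unfolding line_integral_def l_def[symmetric]
  proof (rule nn_integral_mono)
    fix t
    show "(\<Sum>k<N. ennreal (c k) * indicator {s1 k<..<s2 k} t) \<le>
        (\<Sum>k<N. ennreal (c k) * indicator {x. \<alpha> k < norm (x - p) \<and> norm (x - p) < \<beta> k} (arclength_param \<gamma> t))
          * indicator {0..l} t"
      unfolding sum_distrib_right
    proof (rule sum_mono)
      fix k assume "k \<in> {..<N}"
      then show "ennreal (c k) * indicator {s1 k<..<s2 k} t \<le>
        ennreal (c k) * indicator {x. \<alpha> k < norm (x - p) \<and> norm (x - p) < \<beta> k} (arclength_param \<gamma> t)
          * indicator {0..l} t"
        using s[of k] unfolding h_def by (auto simp: indicator_def)
    qed
  qed
  finally show ?thesis .
qed

section \<open>Slicing by hyperplanes\<close>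

lemma measurable_vec_lambda:
  "(\<And>j. (\<lambda>x. f x j) \<in> borel_measurable M) \<Longrightarrow> (\<lambda>x. (\<chi> j. f x j) :: real^'n) \<in> borel_measurable M"
  by (subst borel_measurable_euclidean_space) (auto simp: Basis_vec_def inner_axis)

lemma lborel_vec:
  "(lborel :: (real^'n) measure) = distr (\<Pi>\<^sub>M j\<in>UNIV. lborel) borel (\<lambda>y. \<chi> j. y j)"
proof (rule lborel_eqI)
  interpret product_sigma_finite "\<lambda>_::'n. lborel :: real measure" ..
  have m: "(\<lambda>y. (\<chi> j. y j) :: real^'n) \<in> measurable (\<Pi>\<^sub>M j\<in>UNIV. lborel) borel"
    by (intro measurable_vec_lambda) simp
  fix l u :: "real^'n" assume lu: "\<And>b. b \<in> Basis \<Longrightarrow> l \<bullet> b \<le> u \<bullet> b"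
  then have lu': "l $ j \<le> u $ j" for j
    using lu[of "axis j 1"] by (simp add: inner_axis axis_in_Basis_iff)
  have "(\<lambda>y. \<chi> j. y j) -` box l u \<inter> space (\<Pi>\<^sub>M j\<in>UNIV. lborel) = (\<Pi>\<^sub>E j\<in>UNIV. {l $ j<..<u $ j})"
    by (auto simp: space_PiM mem_box_cart PiE_iff)
  then have "emeasure (distr (\<Pi>\<^sub>M j\<in>UNIV. lborel) borel (\<lambda>y. \<chi> j. y j)) (box l u) =
      emeasure (\<Pi>\<^sub>M j\<in>UNIV. lborel) (\<Pi>\<^sub>E j\<in>UNIV. {l $ j<..<u $ j})"
    by (simp add: emeasure_distr[OF m])
  also have "\<dots> = (\<Prod>j\<in>UNIV. ennreal (u $ j - l $ j))"
    using lu' by (subst emeasure_PiM) auto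
  also have "\<dots> = ennreal (\<Prod>j\<in>UNIV. u $ j - l $ j)"
    using lu' by (intro prod_ennreal) auto
  also have "(\<Prod>j\<in>UNIV. u $ j - l $ j) = (\<Prod>b\<in>Basis. (u - l) \<bullet> b)"
  proof -
    have B: "(Basis :: (real^'n) set) = (\<lambda>j. axis j 1) ` UNIV" by (auto simp: Basis_vec_def)
    have "inj (\<lambda>j::'n. axis j (1::real))" by (auto simp: inj_def axis_eq_axis)
    then show ?thesis unfolding B by (subst prod.reindex) (simp_all add: inner_axis)
  qed
  finally show "emeasure (distr (\<Pi>\<^sub>M j\<in>UNIV. lborel) borel (\<lambda>y. \<chi> j. y j)) (box l u) =
      ennreal (\<Prod>b\<in>Basis. (u - l) \<bullet> b)" by simp
qed simp

lemma nn_integral_lborel_slices: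
  fixes g :: "real^'n \<Rightarrow> ennreal"
  assumes [measurable]: "g \<in> borel_measurable borel"
  shows "(\<integral>\<^sup>+x. g x \<partial>lborel) =
    (\<integral>\<^sup>+t. \<integral>\<^sup>+y. g (\<chi> j. if j = i then t else y j) \<partial>(\<Pi>\<^sub>M j\<in>UNIV - {i}. lborel) \<partial>lborel)"
proof -
  interpret product_sigma_finite "\<lambda>_::'n. lborel :: real measure" ..
  have m[measurable]: "(\<lambda>y. (\<chi> j. y j) :: real^'n) \<in> measurable (\<Pi>\<^sub>M j\<in>UNIV. lborel) borel"
    by (intro measurable_vec_lambda) simp
  have ins: "insert i (UNIV - {i}) = (UNIV :: 'n set)" by auto
  have "(\<integral>\<^sup>+x. g x \<partial>lborel) = (\<integral>\<^sup>+y. g (\<chi> j. y j) \<partial>(\<Pi>\<^sub>M j\<in>insert i (UNIV - {i}). lborel))"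
    unfolding ins by (subst lborel_vec) (simp add: nn_integral_distr)
  also have "\<dots> = (\<integral>\<^sup>+t. \<integral>\<^sup>+y. g (\<chi> j. (y(i := t)) j) \<partial>(\<Pi>\<^sub>M j\<in>UNIV - {i}. lborel) \<partial>lborel)"
    by (rule product_nn_integral_insert_rev) (simp_all add: ins)
  also have "\<dots> = (\<integral>\<^sup>+t. \<integral>\<^sup>+y. g (\<chi> j. if j = i then t else y j) \<partial>(\<Pi>\<^sub>M j\<in>UNIV - {i}. lborel) \<partial>lborel)"
    by (simp add: fun_upd_def)
  finally show ?thesis .
qed

text \<open>Scaling by \<open>s\<close> and translation by \<open>c\<close>, one coordinate at a
  time by Fubini. The restricted abstraction keeps the transformed points extensional, hence inside
  the product space.\<close>

lemma nn_integral_PiM_lborel_affine: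
  fixes c :: "'i \<Rightarrow> real"
  assumes "finite J" and s: "s \<noteq> 0" and "g \<in> borel_measurable (\<Pi>\<^sub>M j\<in>J. lborel)"
  shows "(\<integral>\<^sup>+y. g y \<partial>(\<Pi>\<^sub>M j\<in>J. lborel)) =
    ennreal (\<bar>s\<bar> ^ card J) * (\<integral>\<^sup>+y. g (\<lambda>j\<in>J. c j + s * y j) \<partial>(\<Pi>\<^sub>M j\<in>J. lborel))"
  using assms(1,3)
proof (induction J arbitrary: g rule: finite_induct)
  case empty
  interpret product_sigma_finite "\<lambda>_::'i. lborel :: real measure" ..
  show ?case by (simp add: PiM_empty nn_integral_count_space_finite)
next
  case (insert a J)
  interpret product_sigma_finite "\<lambda>_::'i. lborel :: real measure" ..
  note [measurable] = insert.prems
  have [measurable]: "(\<lambda>(x, y). g (x(a := c a + s * y))) \<in> borel_measurable ((\<Pi>\<^sub>M j\<in>J. lborel) \<Otimes>\<^sub>M lborel)"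
    by measurable
  define G where "G x = (\<integral>\<^sup>+y. g (x(a := c a + s * y)) \<partial>lborel)" for x
  have G: "G \<in> borel_measurable (\<Pi>\<^sub>M j\<in>J. lborel)"
    unfolding G_def by measurable
  have aff: "(\<lambda>y. g (\<lambda>j\<in>insert a J. c j + s * y j)) \<in> borel_measurable (\<Pi>\<^sub>M j\<in>insert a J. lborel)"
    by measurable
  have "(\<integral>\<^sup>+y. g y \<partial>(\<Pi>\<^sub>M j\<in>insert a J. lborel)) =
      (\<integral>\<^sup>+x. \<integral>\<^sup>+y. g (x(a := y)) \<partial>lborel \<partial>(\<Pi>\<^sub>M j\<in>J. lborel))"
    using insert.hyps insert.prems by (intro product_nn_integral_insert) auto
  also have "\<dots> = (\<integral>\<^sup>+x. ennreal \<bar>s\<bar> * G x \<partial>(\<Pi>\<^sub>M j\<in>J. lborel))"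
  proof (rule nn_integral_cong)
    fix x assume x: "x \<in> space (\<Pi>\<^sub>M j\<in>J. lborel :: real measure)"
    have [measurable]: "(\<lambda>y. g (x(a := y))) \<in> borel_measurable borel"
      using x by measurable
    show "(\<integral>\<^sup>+y. g (x(a := y)) \<partial>lborel) = ennreal \<bar>s\<bar> * G x"
      unfolding G_def using s by (rule nn_integral_real_affine[rotated]) measurable
  qed
  also have "\<dots> = ennreal \<bar>s\<bar> * (\<integral>\<^sup>+x. G x \<partial>(\<Pi>\<^sub>M j\<in>J. lborel))"
    using G by (rule nn_integral_cmult)
  also have "\<dots> = ennreal \<bar>s\<bar> * (ennreal (\<bar>s\<bar> ^ card J) *
      (\<integral>\<^sup>+x. G (\<lambda>j\<in>J. c j + s * x j) \<partial>(\<Pi>\<^sub>M j\<in>J. lborel)))"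
    by (subst insert.IH[OF G]) simp
  also have "(\<integral>\<^sup>+x. G (\<lambda>j\<in>J. c j + s * x j) \<partial>(\<Pi>\<^sub>M j\<in>J. lborel)) =
      (\<integral>\<^sup>+x. \<integral>\<^sup>+y. g (\<lambda>j\<in>insert a J. c j + s * (x(a := y)) j) \<partial>lborel \<partial>(\<Pi>\<^sub>M j\<in>J. lborel))"
  proof (intro nn_integral_cong, unfold G_def, intro nn_integral_cong)
    fix x y
    have "(\<lambda>j\<in>J. c j + s * x j)(a := c a + s * y) = (\<lambda>j\<in>insert a J. c j + s * (x(a := y)) j)"
      using insert.hyps by (auto simp: fun_eq_iff)
    then show "g ((\<lambda>j\<in>J. c j + s * x j)(a := c a + s * y)) =
        g (\<lambda>j\<in>insert a J. c j + s * (x(a := y)) j)" by simp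
  qed
  also have "\<dots> = (\<integral>\<^sup>+y. g (\<lambda>j\<in>insert a J. c j + s * y j) \<partial>(\<Pi>\<^sub>M j\<in>insert a J. lborel))"
    using insert.hyps aff by (intro product_nn_integral_insert[symmetric]) auto
  finally show ?case
    by (simp only: card_insert_disjoint[OF insert.hyps] power_Suc ennreal_mult abs_ge_zero zero_le_power mult.assoc)
qed

section \<open>Positive capacity of a point in a hyperplane\<close>

lemma ennreal_weighted_power_bound:
  fixes h :: ennreal
  assumes k: "0 < k"
  shows "h \<le> ennreal k + ennreal (1 / k ^ m) * h ^ Suc m"
\<comment> \<open>A weak form of Young's inequality with a free weight \<open>k\<close>: above
  \<open>k\<close>, the factor \<open>(h / k) ^ m\<close> is at least 1. The weight will depend on
  the position along the segment.\<close>
proof (cases "h \<le> ennreal k")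
  case True
  then show ?thesis by (simp add: add_increasing2)
next
  case False
  show ?thesis
  proof (cases h)
    case (real r)
    then have r: "k < r" using False k by (auto simp: not_le ennreal_less_iff)
    have "r * k ^ m \<le> r * r ^ m"
      using r k by (intro mult_left_mono power_mono) auto
    then have "r \<le> 1 / k ^ m * r ^ Suc m"
      using k by (simp add: field_simps)
    then have "ennreal r \<le> ennreal (1 / k ^ m) * ennreal r ^ Suc m"
      using r k by (simp add: ennreal_mult[symmetric] ennreal_power del: power_Suc)
    then show ?thesis using real by (simp add: add_increasing del: power_Suc)
  next
    case top
    then show ?thesis using k by (simp add: ennreal_mult_top)
  qed
qed

lemma nn_integral_powr_unit:
  assumes a: "-1 < a"
  shows "(\<integral>\<^sup>+s\<in>{0<..1}. ennreal (s powr a) \<partial>lborel) = ennreal (1 / (a + 1))"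
proof -
  have "((\<lambda>s. s powr a) has_integral (1 powr (a + 1) / (a + 1))) {0..1}"
    using a by (intro has_integral_powr_from_0) auto
  then have "((\<lambda>s. if s \<in> {0..1} then s powr a else 0) has_integral 1 / (a + 1)) UNIV"
    by (simp only: has_integral_restrict_UNIV) simp
  also have "(\<lambda>s. if s \<in> {0..1} then s powr a else 0) = (\<lambda>s. indicator {0..1} s *\<^sub>R s powr a)"
    by auto
  finally have "((\<lambda>s. indicator {0..1} s *\<^sub>R s powr a) has_integral 1 / (a + 1)) UNIV" .
  then have "(\<integral>\<^sup>+s. ennreal (indicator {0..1} s *\<^sub>R s powr a) \<partial>lborel) = ennreal (1 / (a + 1))"
    by (intro nn_integral_has_integral_lborel) auto
  moreover have "(\<integral>\<^sup>+s\<in>{0<..1}. ennreal (s powr a) \<partial>lborel) =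
      (\<integral>\<^sup>+s. ennreal (indicator {0..1} s *\<^sub>R s powr a) \<partial>lborel)"
    by (intro nn_integral_cong) (auto simp: indicator_def)
  ultimately show ?thesis by simp
qed

text \<open>
  Radial segments from \<open>c\<close> in a hyperplane of dimension \<open>m\<close>: the weight \<open>s powr (- m / (m + 1))\<close>
  in Young's inequality balances its own integral against the factor \<open>s ^ (- m)\<close> from scaling.
\<close>
lemma slice_power_integral_ge:
  fixes h :: "('i \<Rightarrow> real) \<Rightarrow> ennreal" and c :: "'i \<Rightarrow> real"
  assumes J: "finite J" "card J = m"
    and h[measurable]: "h \<in> borel_measurable (\<Pi>\<^sub>M j\<in>J. lborel)"
    and M: "0 < M"
    and seg: "\<And>y. y \<in> (\<Pi>\<^sub>E j\<in>J. {a..a + 1}) \<Longrightarrow>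
       1 \<le> ennreal M * (\<integral>\<^sup>+s\<in>{0<..1}. h (\<lambda>j\<in>J. c j + s * y j) \<partial>lborel)"
  shows "ennreal ((1 / (2 * M * Suc m)) ^ Suc m) \<le> (\<integral>\<^sup>+y. h y ^ Suc m \<partial>(\<Pi>\<^sub>M j\<in>J. lborel))"
proof -
  interpret product_sigma_finite "\<lambda>_::'i. lborel :: real measure" ..
  let ?P = "\<Pi>\<^sub>M j\<in>J. (lborel :: real measure)"
  interpret P: sigma_finite_measure ?P using J by (intro sigma_finite)
  interpret PL: pair_sigma_finite ?P lborel ..
  \<comment> \<open>The directions fill a cube of unit volume instead of a sphere, so plain scaling
    takes the place of polar coordinates.\<close>
  define A where "A = (\<Pi>\<^sub>E j\<in>J. {a..a + 1::real})"
  define I where "I = (\<integral>\<^sup>+y. h y ^ Suc m \<partial>?P)"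
  \<comment> \<open>Chosen so that \<open>M * Suc m * \<epsilon> = 1 / 2\<close>: the first term of
    the final estimate takes up half of the 1, and the other half forces \<open>I\<close> to be at
    least \<open>\<epsilon> ^ Suc m\<close>.\<close>
  define \<epsilon> where "\<epsilon> = 1 / (2 * M * Suc m)"
  define \<theta> where "\<theta> = - real m / Suc m"
  have \<epsilon>: "0 < \<epsilon>" using M by (simp add: \<epsilon>_def)
  have A[measurable]: "A \<in> sets ?P" unfolding A_def using J by (intro sets_PiM_I_finite) auto
  have A1: "emeasure ?P A = 1"
    unfolding A_def using J by (subst emeasure_PiM) auto
  have [measurable]: "(\<lambda>(y, s). h (\<lambda>j\<in>J. c j + s * y j)) \<in> borel_measurable (?P \<Otimes>\<^sub>M lborel)"
    by measurable
  have Z: "(\<integral>\<^sup>+s\<in>{0<..1}. ennreal (s powr \<theta>) \<partial>lborel) = ennreal (Suc m)"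
  proof -
    have "1 / (\<theta> + 1) = Suc m" "-1 < \<theta>" by (auto simp: \<theta>_def field_simps)
    then show ?thesis using nn_integral_powr_unit[of \<theta>] by simp
  qed
  have "1 = (\<integral>\<^sup>+y. 1 * indicator A y \<partial>?P)" using A1 by simp
  also have "\<dots> \<le> (\<integral>\<^sup>+y. ennreal M * (\<integral>\<^sup>+s\<in>{0<..1}. h (\<lambda>j\<in>J. c j + s * y j) \<partial>lborel) * indicator A y \<partial>?P)"
    using seg by (intro nn_integral_mono) (auto simp: A_def indicator_def)
  also have "\<dots> = ennreal M * (\<integral>\<^sup>+y. (\<integral>\<^sup>+s\<in>{0<..1}. h (\<lambda>j\<in>J. c j + s * y j) \<partial>lborel) * indicator A y \<partial>?P)"
    by (simp add: mult.assoc nn_integral_cmult)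
  also have "(\<integral>\<^sup>+y. (\<integral>\<^sup>+s\<in>{0<..1}. h (\<lambda>j\<in>J. c j + s * y j) \<partial>lborel) * indicator A y \<partial>?P) =
      (\<integral>\<^sup>+y. (\<integral>\<^sup>+s. h (\<lambda>j\<in>J. c j + s * y j) * indicator {0<..1} s * indicator A y \<partial>lborel) \<partial>?P)"
    by (intro nn_integral_cong nn_integral_multc[symmetric]) measurable
  also have "\<dots> = (\<integral>\<^sup>+s. (\<integral>\<^sup>+y. h (\<lambda>j\<in>J. c j + s * y j) * indicator {0<..1} s * indicator A y \<partial>?P) \<partial>lborel)"
    by (rule PL.Fubini'[symmetric]) measurable
  also have "\<dots> \<le> (\<integral>\<^sup>+s. (ennreal \<epsilon> + ennreal (1 / \<epsilon> ^ m) * I) * (ennreal (s powr \<theta>) * indicator {0<..1} s) \<partial>lborel)"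
  proof (rule nn_integral_mono)
    fix s :: real
    show "(\<integral>\<^sup>+y. h (\<lambda>j\<in>J. c j + s * y j) * indicator {0<..1} s * indicator A y \<partial>?P) \<le>
        (ennreal \<epsilon> + ennreal (1 / \<epsilon> ^ m) * I) * (ennreal (s powr \<theta>) * indicator {0<..1} s)"
    proof (cases "s \<in> {0<..1}")
      case True
      then have s: "0 < s" by simp
      define k where "k = \<epsilon> * s powr \<theta>"
      have k: "0 < k" using \<epsilon> s by (simp add: k_def)
      have "(\<integral>\<^sup>+y. h (\<lambda>j\<in>J. c j + s * y j) * indicator {0<..1} s * indicator A y \<partial>?P) \<le>
          (\<integral>\<^sup>+y. ennreal k * indicator A y + ennreal (1 / k ^ m) * h (\<lambda>j\<in>J. c j + s * y j) ^ Suc m \<partial>?P)"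
        using True ennreal_weighted_power_bound[OF k]
        by (intro nn_integral_mono) (auto simp: indicator_def simp del: power_Suc)
      also have "\<dots> = ennreal k + ennreal (1 / k ^ m) * (\<integral>\<^sup>+y. h (\<lambda>j\<in>J. c j + s * y j) ^ Suc m \<partial>?P)"
        using A1 by (subst nn_integral_add) (simp_all add: nn_integral_cmult_indicator nn_integral_cmult del: power_Suc)
      also have "ennreal (1 / k ^ m) * (\<integral>\<^sup>+y. h (\<lambda>j\<in>J. c j + s * y j) ^ Suc m \<partial>?P) =
          ennreal (1 / \<epsilon> ^ m * s powr \<theta>) * (ennreal (s ^ m) * (\<integral>\<^sup>+y. h (\<lambda>j\<in>J. c j + s * y j) ^ Suc m \<partial>?P))"
      proof -
        \<comment> \<open>This equation determines \<theta>. It makes \<open>1 / k ^ m\<close> a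
          multiple of \<open>s powr \<theta> * s ^ m\<close>, whose factor \<open>s ^ m\<close> is
          exactly the Jacobian of the scaling, leaving the integrable weight.\<close>
        have "\<theta> = - (\<theta> * m) - m" by (simp add: \<theta>_def field_simps)
        then have "s powr \<theta> = s powr (- (\<theta> * m) - m)" by simp
        also have "\<dots> = 1 / ((s powr \<theta>) ^ m * s ^ m)"
          using s by (simp add: powr_diff powr_minus powr_powr[symmetric] powr_realpow field_simps)
        finally have X: "s powr \<theta> = 1 / ((s powr \<theta>) ^ m * s ^ m)" .
        have "s powr \<theta> * s ^ m = 1 / (s powr \<theta>) ^ m"
          by (subst X) (use s in simp)
        then have "1 / k ^ m = 1 / \<epsilon> ^ m * s powr \<theta> * s ^ m"
          by (simp add: k_def power_mult_distrib)
        then have "ennreal (1 / k ^ m) = ennreal (1 / \<epsilon> ^ m * s powr \<theta>) * ennreal (s ^ m)"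
          using s \<epsilon> by (simp only: flip: ennreal_mult') (simp add: ennreal_mult'[symmetric])
        then show ?thesis by (simp only: mult.assoc)
      qed
      also have "ennreal (s ^ m) * (\<integral>\<^sup>+y. h (\<lambda>j\<in>J. c j + s * y j) ^ Suc m \<partial>?P) = I"
        unfolding I_def
        using nn_integral_PiM_lborel_affine[OF J(1), of s "\<lambda>y. h y ^ Suc m" c] s J
        by (simp del: power_Suc)
      also have "ennreal k + ennreal (1 / \<epsilon> ^ m * s powr \<theta>) * I =
          (ennreal \<epsilon> + ennreal (1 / \<epsilon> ^ m) * I) * (ennreal (s powr \<theta>) * indicator {0<..1} s)"
      proof -
        have 1: "ennreal k = ennreal \<epsilon> * ennreal (s powr \<theta>)"
          using \<epsilon> by (simp add: k_def ennreal_mult)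
        have 2: "ennreal (1 / \<epsilon> ^ m * s powr \<theta>) = ennreal (1 / \<epsilon> ^ m) * ennreal (s powr \<theta>)"
          using \<epsilon> by (intro ennreal_mult) auto
        show ?thesis unfolding 1 2 using True by (simp add: distrib_left distrib_right mult_ac)
      qed
      finally show ?thesis .
    qed simp
  qed
  also have "\<dots> = (ennreal \<epsilon> + ennreal (1 / \<epsilon> ^ m) * I) * ennreal (Suc m)"
    by (subst nn_integral_cmult) (simp_all add: Z)
  finally have main: "1 \<le> ennreal M * ((ennreal \<epsilon> + ennreal (1 / \<epsilon> ^ m) * I) * ennreal (Suc m))"
    by (simp add: mult_left_mono)
  have "ennreal (\<epsilon> ^ Suc m) \<le> I"
  proof (cases I)
    case (real r)
    have "ennreal (1 / \<epsilon> ^ m) * ennreal r = ennreal (1 / \<epsilon> ^ m * r)"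
      using real \<epsilon> by (intro ennreal_mult[symmetric]) auto
    moreover have "ennreal \<epsilon> + ennreal (1 / \<epsilon> ^ m * r) = ennreal (\<epsilon> + 1 / \<epsilon> ^ m * r)"
      using real \<epsilon> by (intro ennreal_plus[symmetric]) auto
    moreover have "ennreal (\<epsilon> + 1 / \<epsilon> ^ m * r) * ennreal (Suc m) = ennreal ((\<epsilon> + 1 / \<epsilon> ^ m * r) * Suc m)"
      using real \<epsilon> by (intro ennreal_mult[symmetric]) auto
    moreover have "ennreal M * ennreal ((\<epsilon> + 1 / \<epsilon> ^ m * r) * Suc m) = ennreal (M * ((\<epsilon> + 1 / \<epsilon> ^ m * r) * Suc m))"
      using real \<epsilon> M by (intro ennreal_mult[symmetric]) auto
    ultimately have "ennreal 1 \<le> ennreal (M * ((\<epsilon> + 1 / \<epsilon> ^ m * r) * Suc m))"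
      using main real(2) by (simp only: ennreal_1)
    then have "1 \<le> M * ((\<epsilon> + 1 / \<epsilon> ^ m * r) * Suc m)"
      using real M \<epsilon> by (subst (asm) ennreal_le_iff) auto
    also have "\<dots> = M * Suc m * \<epsilon> + M * Suc m * (1 / \<epsilon> ^ m * r)" by (simp only: distrib_left distrib_right mult_ac)
    also have "M * Suc m * \<epsilon> = 1 / 2" using M by (simp add: \<epsilon>_def)
    finally have "1 / 2 \<le> M * Suc m * (1 / \<epsilon> ^ m * r)" by linarith
    then have "2 * \<epsilon> * (1 / 2) \<le> 2 * \<epsilon> * (M * Suc m * (1 / \<epsilon> ^ m * r))"
      using \<epsilon> by (intro mult_left_mono) auto
    also have "2 * \<epsilon> * (M * Suc m * (1 / \<epsilon> ^ m * r)) = 1 / \<epsilon> ^ m * r" using M by (simp add: \<epsilon>_def)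
    finally have "\<epsilon> ^ Suc m \<le> r" using \<epsilon> by (simp add: field_simps)
    then show ?thesis using real by (simp add: ennreal_leI del: power_Suc)
  qed simp
  then show ?thesis by (simp add: \<epsilon>_def I_def)
qed

section \<open>A lower bound from segments\<close>

lemma linepath_linepath: "linepath (linepath p q t1) (linepath p q t2) u = linepath p q (t1 + u * (t2 - t1))"
  by (simp add: linepath_def algebra_simps)

text \<open>Admissibility controls only the part of a segment that runs in the ring. Enlarging to
  the full segment removes the dependence on that part, and so on the radius.\<close>

lemma line_integral_subsegment_le:
  fixes p q :: "'a::euclidean_space"
  assumes [measurable]: "\<rho> \<in> borel_measurable borel" and t: "0 \<le> t1" "t1 \<le> t2" "t2 \<le> 1"
  shows "line_integral (linepath (linepath p q t1) (linepath p q t2)) \<rho> \<le>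
           ennreal (norm (q - p)) * (\<integral>\<^sup>+s\<in>{0..1}. \<rho> (linepath p q s) \<partial>lborel)"
proof (cases "t1 = t2")
  case True
  then show ?thesis by (simp add: line_integral_linepath)
next
  case False
  define d where "d = t2 - t1"
  have d: "0 < d" using False t by (simp add: d_def)
  have m[measurable]: "linepath p q \<in> borel_measurable borel"
    unfolding linepath_def by measurable
  have "linepath p q t2 - linepath p q t1 = d *\<^sub>R (q - p)"
    by (simp add: linepath_def d_def algebra_simps)
  then have "line_integral (linepath (linepath p q t1) (linepath p q t2)) \<rho> =
      ennreal (norm (q - p)) * (ennreal d * (\<integral>\<^sup>+u\<in>{0..1}. \<rho> (linepath p q (t1 + d * u)) \<partial>lborel))"
    using d by (simp add: line_integral_linepath linepath_linepath d_def ennreal_mult mult_ac)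
  also have "ennreal d * (\<integral>\<^sup>+u\<in>{0..1}. \<rho> (linepath p q (t1 + d * u)) \<partial>lborel) =
      ennreal \<bar>d\<bar> * (\<integral>\<^sup>+u. \<rho> (linepath p q (t1 + d * u)) * indicator {t1..t2} (t1 + d * u) \<partial>lborel)"
  proof -
    have "indicator {0..1} u = (indicator {t1..t2} (t1 + d * u) :: ennreal)" for u
    proof -
      have "t1 + d * u \<le> t2 \<longleftrightarrow> d * u \<le> d * 1" by (auto simp: d_def)
      also have "\<dots> \<longleftrightarrow> u \<le> 1" using d by (rule mult_le_cancel_left_pos)
      finally show ?thesis using d by (auto simp: indicator_def zero_le_mult_iff)
    qed
    then show ?thesis using d by simp
  qed
  also have "\<dots> = (\<integral>\<^sup>+s\<in>{t1..t2}. \<rho> (linepath p q s) \<partial>lborel)"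
    using d by (intro nn_integral_real_affine[symmetric]) auto
  also have "\<dots> \<le> (\<integral>\<^sup>+s\<in>{0..1}. \<rho> (linepath p q s) \<partial>lborel)"
    using t by (intro nn_integral_mono) (auto simp: indicator_def)
  finally show ?thesis by (simp add: mult_left_mono)
qed

text \<open>
  Every hyperplane \<open>x $ i = t\<close> between two points of \<open>C\<close> meets \<open>C\<close>. The segments issuing from such a
  common point inside the hyperplane give a lower bound for the power integral over the hyperplane
  that does not depend on \<open>t\<close>.
\<close>
lemma power_integral_ge_of_segments:
  fixes C U :: "(real^'n) set"
  assumes n: "CARD('n) \<ge> 2" and C: "connected C" "x \<in> C" "y \<in> C" "x \<noteq> y"
    and U: "bounded U" "C \<subseteq> U"
  obtains \<kappa> where "0 < \<kappa>"
    "\<And>\<rho>. \<rho> \<in> borel_measurable borel \<Longrightarrow>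
       (\<And>p q. p \<in> C \<Longrightarrow> q \<notin> U \<Longrightarrow>
          1 \<le> ennreal (norm (q - p)) * (\<integral>\<^sup>+s\<in>{0..1}. \<rho> (linepath p q s) \<partial>lborel)) \<Longrightarrow>
       ennreal \<kappa> \<le> (\<integral>\<^sup>+x. \<rho> x ^ CARD('n) \<partial>lborel)"
proof -
  obtain i where i: "x $ i \<noteq> y $ i" using C by (auto simp: vec_eq_iff)
  define \<alpha> where "\<alpha> = min (x $ i) (y $ i)"
  define \<beta> where "\<beta> = max (x $ i) (y $ i)"
  have \<alpha>\<beta>: "\<alpha> < \<beta>" using i by (auto simp: \<alpha>_def \<beta>_def)
  have "connected ((\<lambda>p. p $ i) ` C)"
    by (intro connected_continuous_image C continuous_intros)
  then have proj: "\<exists>p\<in>C. p $ i = t" if "t \<in> {\<alpha>..\<beta>}" for t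
    using connectedD_interval[of "(\<lambda>p. p $ i) ` C" \<alpha> \<beta> t] that C
    by (auto simp: \<alpha>_def \<beta>_def min_def max_def split: if_splits)
  obtain B where B: "0 < B" "\<And>p. p \<in> U \<Longrightarrow> norm p \<le> B" using U(1) bounded_pos by blast
  \<comment> \<open>A displacement by more than \<open>2 * B\<close> in one coordinate takes a point
    of norm at most \<open>B\<close> out of \<open>U\<close>. \<open>M\<close> bounds the sum of the
    absolute coordinates, hence the norm, of such a displacement.\<close>
  define a where "a = 2 * B + 1"
  define M where "M = CARD('n) * (a + 1)"
  have a: "0 < a" using B by (simp add: a_def)
  have M: "0 < M" using a n by (simp add: M_def)
  let ?J = "UNIV - {i}"
  obtain m where m: "CARD('n) = Suc m" "0 < m" using n by (cases "CARD('n)") auto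
  have J: "finite ?J" "card ?J = m" using m by (auto simp: card_Diff_singleton)
  define \<kappa> where "\<kappa> = (1 / (2 * M * Suc m)) ^ Suc m"
  have \<kappa>: "0 < \<kappa>" using M by (simp add: \<kappa>_def)
  have "ennreal (\<kappa> * (\<beta> - \<alpha>)) \<le> (\<integral>\<^sup>+x. \<rho> x ^ CARD('n) \<partial>lborel)"
    if \<rho>[measurable]: "\<rho> \<in> borel_measurable borel"
      and seg: "\<And>p q. p \<in> C \<Longrightarrow> q \<notin> U \<Longrightarrow>
        1 \<le> ennreal (norm (q - p)) * (\<integral>\<^sup>+s\<in>{0..1}. \<rho> (linepath p q s) \<partial>lborel)" for \<rho>
  proof -
    define I where "I t = (\<integral>\<^sup>+y. \<rho> (\<chi> j. if j = i then t else y j) ^ CARD('n) \<partial>(\<Pi>\<^sub>M j\<in>?J. lborel))" for t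
    have "ennreal \<kappa> \<le> I t" if t: "t \<in> {\<alpha>..\<beta>}" for t
    proof -
      obtain p where p: "p \<in> C" "p $ i = t" using proj t by blast
      define h where "h y = \<rho> (\<chi> j. if j = i then t else y j)" for y :: "'n \<Rightarrow> real"
      have "(\<lambda>y. (\<chi> j. if j = i then t else y j) :: real^'n) \<in> borel_measurable (\<Pi>\<^sub>M j\<in>?J. lborel)"
      proof (rule measurable_vec_lambda)
        fix j
        show "(\<lambda>y. if j = i then t else y j) \<in> borel_measurable (\<Pi>\<^sub>M j\<in>?J. lborel)"
          by (cases "j = i") auto
      qed
      then have h: "h \<in> borel_measurable (\<Pi>\<^sub>M j\<in>?J. lborel)"
        unfolding h_def by measurable
      have "1 \<le> ennreal M * (\<integral>\<^sup>+s\<in>{0<..1}. h (\<lambda>j\<in>?J. p $ j + s * y j) \<partial>lborel)"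
        if y: "y \<in> (\<Pi>\<^sub>E j\<in>?J. {a..a + 1})" for y
      proof -
        define v :: "real^'n" where "v = (\<chi> j. if j = i then 0 else y j)"
        have yj: "a \<le> y j" "y j \<le> a + 1" if "j \<noteq> i" for j using y that by (auto simp: PiE_iff)
        have v: "norm v \<le> M"
        proof -
          have "\<bar>v $ j\<bar> \<le> a + 1" for j using yj[of j] a by (auto simp: v_def)
          then have "(\<Sum>j\<in>UNIV. \<bar>v $ j\<bar>) \<le> (\<Sum>j\<in>(UNIV::'n set). a + 1)" by (intro sum_mono) auto
          then show ?thesis using norm_le_l1_cart[of v] by (simp add: M_def)
        qed
        have "p + v \<notin> U"
        proof
          assume "p + v \<in> U"
          \<comment> \<open>The assumption \<open>n \<ge> 2\<close> enters here: the hyperplane has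
            at least one direction in which to leave \<open>U\<close>.\<close>
          obtain j where j: "j \<noteq> i" using J m by (metis DiffE card.empty equals0I insertI1 less_irrefl)
          have "norm p \<le> B" "norm (p + v) \<le> B" using B p U \<open>p + v \<in> U\<close> by auto
          then have "\<bar>p $ j\<bar> \<le> B" "\<bar>p $ j + v $ j\<bar> \<le> B"
            using component_le_norm_cart[of p j] component_le_norm_cart[of "p + v" j] by auto
          moreover have "v $ j = y j" using j by (simp add: v_def)
          ultimately show False using yj[OF j] a by (simp add: a_def)
        qed
        then have "1 \<le> ennreal (norm v) * (\<integral>\<^sup>+s\<in>{0..1}. \<rho> (linepath p (p + v) s) \<partial>lborel)"
          using seg[of p "p + v"] p by simp
        also have "\<dots> \<le> ennreal M * (\<integral>\<^sup>+s\<in>{0..1}. \<rho> (linepath p (p + v) s) \<partial>lborel)"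
          using v by (intro mult_right_mono ennreal_leI) auto
        also have "(\<integral>\<^sup>+s\<in>{0..1}. \<rho> (linepath p (p + v) s) \<partial>lborel) =
            (\<integral>\<^sup>+s\<in>{0<..1}. h (\<lambda>j\<in>?J. p $ j + s * y j) \<partial>lborel)"
        proof (rule nn_integral_cong_AE)
          show "AE s in lborel. \<rho> (linepath p (p + v) s) * indicator {0..1} s =
              h (\<lambda>j\<in>?J. p $ j + s * y j) * indicator {0<..1} s"
            using AE_lborel_singleton[of "0::real"]
          proof eventually_elim
            case (elim s)
            have "linepath p (p + v) s = (\<chi> j. if j = i then t else (\<lambda>j\<in>?J. p $ j + s * y j) j)"
              using p by (auto simp: vec_eq_iff linepath_def v_def algebra_simps)
            then show ?case using elim by (auto simp: h_def indicator_def)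
          qed
        qed
        finally show ?thesis .
      qed
      from slice_power_integral_ge[OF J h M this]
      show ?thesis unfolding I_def h_def \<kappa>_def m(1) by simp
    qed
    then have "ennreal \<kappa> * indicator {\<alpha>..\<beta>} t \<le> I t" for t
      by (auto simp: indicator_def)
    then have "(\<integral>\<^sup>+t. ennreal \<kappa> * indicator {\<alpha>..\<beta>} t \<partial>lborel) \<le> (\<integral>\<^sup>+t. I t \<partial>lborel)"
      by (intro nn_integral_mono)
    moreover have "(\<integral>\<^sup>+t. ennreal \<kappa> * indicator {\<alpha>..\<beta>} t \<partial>lborel) = ennreal (\<kappa> * (\<beta> - \<alpha>))"
      using \<alpha>\<beta> \<kappa> by (simp add: nn_integral_cmult_indicator ennreal_mult)
    moreover have "(\<integral>\<^sup>+x. \<rho> x ^ CARD('n) \<partial>lborel) = (\<integral>\<^sup>+t. I t \<partial>lborel)"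
      unfolding I_def by (rule nn_integral_lborel_slices) measurable
    ultimately show ?thesis by simp
  qed
  moreover have "0 < \<kappa> * (\<beta> - \<alpha>)" using \<kappa> \<alpha>\<beta> by simp
  ultimately show ?thesis using that[of "\<kappa> * (\<beta> - \<alpha>)"] by blast
qed

section \<open>Moduli of the image rings\<close>

lemma connectedin_Some_image:
  "connected S \<Longrightarrow> connectedin (Alexandroff_compactification euclidean) (Some ` S)"
  by (intro connectedin_continuous_map_image[OF continuous_map_Some]) simp

text \<open>An unbounded set leaves every compact set, so infinity lies in its closure, and adding a
  limit point preserves connectedness.\<close>

lemma connectedin_insert_None:
  fixes S :: "'a::euclidean_space set"
  assumes "connected S" "\<not> bounded S"
  shows "connectedin (Alexandroff_compactification euclidean) (insert None (Some ` S))"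
proof (rule connectedin_intermediate_closure_of[OF connectedin_Some_image[OF assms(1)]])
  let ?X = "Alexandroff_compactification (euclidean :: 'a topology)"
  have "None \<in> ?X closure_of (Some ` S)"
    unfolding in_closure_of
  proof (intro conjI allI impI)
    fix V assume V: "None \<in> V \<and> openin ?X V"
    then obtain K where K: "compact K" "V = insert None (Some ` (UNIV - K))"
      by (auto simp: openin_Alexandroff_compactification)
    then have "\<not> S \<subseteq> K" using assms(2) bounded_subset compact_imp_bounded by blast
    then show "\<exists>y. y \<in> Some ` S \<and> y \<in> V" using K by blast
  qed simp
  then show "insert None (Some ` S) \<subseteq> ?X closure_of (Some ` S)"
    using closure_of_subset[of "Some ` S" ?X] by auto
qed auto

lemma compactin_insert_None:
  assumes "open U"
  shows "compactin (Alexandroff_compactification euclidean) (insert None (Some ` (- U)))"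
proof (rule closedin_compact_space)
  have "insert None (Some ` (- U)) = topspace (Alexandroff_compactification euclidean) - Some ` U"
    by auto
  then show "closedin (Alexandroff_compactification euclidean) (insert None (Some ` (- U)))"
    unfolding closedin_Alexandroff_compactification using assms by auto
qed simp

lemma connectedin_subset_closed_cover:
  assumes "connectedin X S" "closedin X A" "closedin X B" "A \<inter> B = {}" "S \<subseteq> A \<union> B"
  shows "S \<subseteq> A \<or> S \<subseteq> B"
  using assms unfolding connectedin_closedin by blast

text \<open>Each of the connected sets \<open>A\<close> and \<open>B\<close> is covered by the
  disjoint closed sets \<open>C0\<close> and \<open>C1\<close>, so it lies in one of them. As
  \<open>ring_curves\<close> quantifies over all decompositions, this is what locates the endpoints
  of a given curve.\<close>

lemma is_ring_unique:
  fixes R :: "(real^'n) option set"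
  assumes ring: "is_ring R A B" and ring': "is_ring R C0 C1"
  shows "C0 = A \<and> C1 = B \<or> C0 = B \<and> C1 = A"
proof -
  have "Hausdorff_space (ext_space :: (real^'n) option topology)"
    by (simp add: Hausdorff_space_Alexandroff_compactification locally_compact_space_euclidean
        Hausdorff_space_euclidean)
  then have cl: "closedin ext_space C0" "closedin ext_space C1"
    using ring' compactin_imp_closedin unfolding is_ring_def continuum_in_def by blast+
  have U: "C0 \<union> C1 = A \<union> B" "C0 \<inter> C1 = {}" "C0 \<noteq> {}" "C1 \<noteq> {}"
      "A \<inter> B = {}" "connectedin ext_space A" "connectedin ext_space B"
    using ring ring' unfolding is_ring_def continuum_in_def by blast+
  have "A \<subseteq> C0 \<or> A \<subseteq> C1" "B \<subseteq> C0 \<or> B \<subseteq> C1"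
    using U cl by (intro connectedin_subset_closed_cover[where X = ext_space]; blast)+
  then show ?thesis using U by blast
qed

locale nested_sphere_embedding_cart = nested_sphere_embedding f
  for f :: "real^'n \<Rightarrow> real^'n"
begin

text \<open>The point at infinity belongs to the outer continuum, whose connectedness therefore
  rests on the complement of the domain being connected and unbounded.\<close>

lemma is_ring_shell:
  assumes r: "0 < r" "r < 1"
  shows "is_ring (Some ` shell {r<..<1}) (Some ` filled r) (insert None (Some ` (- interior_domain)))"
  unfolding is_ring_def continuum_in_def
proof (intro conjI)
  note split = interior_domain_diff_filled[OF r] filled_subset_interior_domain[OF r]
  show "Some ` shell {r<..<1} = UNIV - (Some ` filled r \<union> insert None (Some ` (- interior_domain)))"
  proof (rule set_eqI)
    fix z :: "(real^'n) option"
    show "z \<in> Some ` shell {r<..<1} \<longleftrightarrow>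
        z \<in> UNIV - (Some ` filled r \<union> insert None (Some ` (- interior_domain)))"
      using split by (cases z) auto
  qed
  have "open (shell {r<..<1})" using r by (intro open_shell) auto
  then show "openin ext_space (Some ` shell {r<..<1})" by simp
  show "connectedin ext_space (Some ` shell {r<..<1})"
    using r by (intro connectedin_Some_image connected_shell_open) auto
  have "{r<..<1} \<noteq> {}" "{r<..<1} \<subseteq> {0..}" using r by auto
  from shell_ne[OF this] show "Some ` shell {r<..<1} \<noteq> {}" by simp
  have "compact (filled r)" using compact_filled r by simp
  then show "compactin ext_space (Some ` filled r)"
    by (intro image_compactin[OF _ continuous_map_Some]) simp
  show "connectedin ext_space (Some ` filled r)"
    using r by (intro connectedin_Some_image connected_filled) auto
  show "Some ` filled r \<noteq> {}" using cavity_ne cavity_subset[OF r] by blast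
  show "compactin ext_space (insert None (Some ` (- interior_domain)))"
    by (rule compactin_insert_None[OF open_interior_domain])
  show "connectedin ext_space (insert None (Some ` (- interior_domain)))"
    by (rule connectedin_insert_None[OF connected_Compl_interior_domain unbounded_Compl_interior_domain])
  show "insert None (Some ` (- interior_domain)) \<noteq> {}" by simp
  show "Some ` filled r \<inter> insert None (Some ` (- interior_domain)) = {}" using split by auto
  have "- Some ` filled r = insert None (Some ` outside (shell {r}))"
  proof (rule set_eqI)
    fix z :: "(real^'n) option"
    show "z \<in> - Some ` filled r \<longleftrightarrow> z \<in> insert None (Some ` outside (shell {r}))"
      by (cases z) (auto simp: filled_eq)
  qed
  moreover have b: "bounded (shell {r})"
    using r by (intro compact_imp_bounded compact_shell) auto
  ultimately show "connectedin ext_space (- Some ` filled r)"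
    using connectedin_insert_None[OF connected_outside[OF b dim] unbounded_outside[OF b]] by simp
  have "- insert None (Some ` (- interior_domain)) = Some ` interior_domain"
  proof (rule set_eqI)
    fix z :: "(real^'n) option"
    show "z \<in> - insert None (Some ` (- interior_domain)) \<longleftrightarrow> z \<in> Some ` interior_domain"
      by (cases z) auto
  qed
  then show "connectedin ext_space (- insert None (Some ` (- interior_domain)))"
    using connectedin_Some_image[OF connected_interior_domain] by simp
qed

section \<open>Curves that join the boundary parts\<close>

lemma ring_curves_shell_endpoints:
  assumes r: "0 < r" "r < 1" and \<gamma>: "\<gamma> \<in> ring_curves (Some ` shell {r<..<1})"
  shows "\<gamma> 0 \<in> filled r \<and> \<gamma> 1 \<notin> interior_domain \<or> \<gamma> 1 \<in> filled r \<and> \<gamma> 0 \<notin> interior_domain"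
proof -
  obtain C0 C1 where C: "is_ring (Some ` shell {r<..<1}) C0 C1" "Some (\<gamma> 0) \<in> C0" "Some (\<gamma> 1) \<in> C1"
    using \<gamma> by (auto simp: ring_curves_def pathstart_def pathfinish_def)
  show ?thesis
    using is_ring_unique[OF is_ring_shell[OF r] C(1)] C(2,3) by auto
qed

text \<open>
  The subsegment runs from the last point of the segment in \<open>filled r\<close> that precedes the first exit
  from the domain.
\<close>
lemma subsegment_in_ring_curves:
  assumes r: "0 < r" "r < 1" and p: "p \<in> filled r" and q: "q \<notin> interior_domain"
  obtains t1 t2 where "0 \<le> t1" "t1 \<le> t2" "t2 \<le> 1"
    "linepath (linepath p q t1) (linepath p q t2) \<in> ring_curves (Some ` shell {r<..<1})"
proof -
  let ?g = "linepath p q"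
  have cont: "continuous_on {0..1} ?g" by (intro continuous_intros)
  define A where "A = {0..1} \<inter> ?g -` (- interior_domain)"
  have "closed A" unfolding A_def using open_interior_domain cont
    by (intro continuous_closed_preimage) auto
  moreover have "bounded A" by (rule bounded_subset[of "{0..1}"]) (auto simp: A_def)
  ultimately have "compact A" by (simp add: compact_eq_bounded_closed)
  moreover have "1 \<in> A" using q by (simp add: A_def linepath_1')
  ultimately obtain t2 where t2: "t2 \<in> A" "\<forall>s\<in>A. t2 \<le> s"
    using compact_attains_inf[of A] by blast
  define B where "B = {0..t2} \<inter> ?g -` filled r"
  have "closed B" unfolding B_def
    using compact_filled[of r] r t2 continuous_on_subset[OF cont, of "{0..t2}"]
    by (intro continuous_closed_preimage) (auto simp: A_def compact_imp_closed)
  moreover have "bounded B" by (rule bounded_subset[of "{0..t2}"]) (auto simp: B_def)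
  ultimately have "compact B" by (simp add: compact_eq_bounded_closed)
  moreover have "0 \<in> B" using p t2 by (simp add: A_def B_def linepath_0')
  ultimately obtain t1 where t1: "t1 \<in> B" "\<forall>s\<in>B. s \<le> t1"
    using compact_attains_sup[of B] by blast
  have ts: "0 \<le> t1" "t1 \<le> t2" "t2 \<le> 1" using t1 t2 by (auto simp: A_def B_def)
  have "linepath (?g t1) (?g t2) u \<in> shell {r<..<1}" if u: "u \<in> {0<..<1}" for u
  proof -
    define s where "s = t1 + u * (t2 - t1)"
    \<comment> \<open>The point at \<open>t1\<close> lies in \<open>filled r\<close>, inside the
      domain, while the point at \<open>t2\<close> has left it.\<close>
    have ne: "t1 \<noteq> t2" using t1(1) t2(1) filled_subset_interior_domain[OF r] by (auto simp: A_def B_def)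
    have "0 < u * (t2 - t1)" using u ts ne by simp
    moreover have "u * (t2 - t1) < 1 * (t2 - t1)" using u ts ne by (intro mult_strict_right_mono) auto
    ultimately have s: "t1 < s" "s < t2" by (simp_all add: s_def)
    have "s \<notin> A" "s \<notin> B" using s t1 t2 by force+
    then have "?g s \<in> interior_domain - filled r" using s ts by (auto simp: A_def B_def)
    then show ?thesis using interior_domain_diff_filled[OF r] by (simp add: linepath_linepath s_def)
  qed
  then have "linepath (?g t1) (?g t2) \<in> ring_curves (Some ` shell {r<..<1})"
    unfolding ring_curves_def
  proof (intro CollectI conjI exI)
    show "is_ring (Some ` shell {r<..<1}) (Some ` filled r) (insert None (Some ` (- interior_domain)))"
      by (rule is_ring_shell[OF r])
  qed (use t1(1) t2(1) in \<open>auto simp: A_def B_def\<close>)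
  then show ?thesis using that ts by blast
qed

section \<open>Bounds for the modulus of the joining curves\<close>

lemma modulus_ge_of_cavity:
  assumes "x \<in> cavity" "y \<in> cavity" "x \<noteq> y"
  obtains \<kappa> where "0 < \<kappa>"
    "\<And>r. 0 < r \<Longrightarrow> r < 1 \<Longrightarrow> ennreal \<kappa> \<le> modulus (ring_curves (Some ` shell {r<..<1}))"
proof -
  have n: "CARD('n) \<ge> 2" using dim by simp
  show thesis
  \<comment> \<open>The constant comes from \<open>cavity\<close> and \<open>interior_domain\<close>
    alone, before any \<open>r\<close> is fixed. Since the cavity lies in every
    \<open>filled r\<close>, the same segments serve all rings.\<close>
  proof (rule power_integral_ge_of_segments[OF n connected_cavity assms bounded_interior_domain
        cavity_subset_interior_domain])
    fix \<kappa> :: real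
    assume \<kappa>: "0 < \<kappa>"
      "\<And>\<rho>. \<rho> \<in> borel_measurable borel \<Longrightarrow>
         (\<And>p q. p \<in> cavity \<Longrightarrow> q \<notin> interior_domain \<Longrightarrow>
            1 \<le> ennreal (norm (q - p)) * (\<integral>\<^sup>+s\<in>{0..1}. \<rho> (linepath p q s) \<partial>lborel)) \<Longrightarrow>
         ennreal \<kappa> \<le> (\<integral>\<^sup>+x. \<rho> x ^ CARD('n) \<partial>lborel)"
    have "ennreal \<kappa> \<le> modulus (ring_curves (Some ` shell {r<..<1}))" if r: "0 < r" "r < 1" for r
      unfolding modulus_def
    proof (rule INF_greatest)
      fix \<rho> assume \<rho>: "\<rho> \<in> admissible (ring_curves (Some ` shell {r<..<1}))"
      then have meas: "\<rho> \<in> borel_measurable borel" by (simp add: admissible_def)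
      show "ennreal \<kappa> \<le> (\<integral>\<^sup>+x. \<rho> x ^ CARD('n) \<partial>lborel)"
      proof (rule \<kappa>(2)[OF meas])
        fix p q assume pq: "p \<in> cavity" "q \<notin> interior_domain"
        then have "p \<in> filled r" using cavity_subset[OF r] by blast
        then obtain t1 t2 where t: "0 \<le> t1" "t1 \<le> t2" "t2 \<le> 1"
          and c: "linepath (linepath p q t1) (linepath p q t2) \<in> ring_curves (Some ` shell {r<..<1})"
          using subsegment_in_ring_curves[OF r _ pq(2)] by blast
        have "1 \<le> line_integral (linepath (linepath p q t1) (linepath p q t2)) \<rho>"
          using \<rho> c rectifiable_linepath unfolding admissible_def by blast
        also have "\<dots> \<le> ennreal (norm (q - p)) * (\<integral>\<^sup>+s\<in>{0..1}. \<rho> (linepath p q s) \<partial>lborel)"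
          using meas t by (rule line_integral_subsegment_le)
        finally show "1 \<le> ennreal (norm (q - p)) * (\<integral>\<^sup>+s\<in>{0..1}. \<rho> (linepath p q s) \<partial>lborel)" .
      qed
    qed
    then show thesis using that \<kappa>(1) by blast
  qed
qed

text \<open>
  The test function averages over \<open>N\<close> disjoint dyadic annuli around \<open>p\<close>; each contributes the same
  amount to the integral of the \<open>n\<close>-th power, so the total is of order \<open>N ^ (1 - n)\<close>.
\<close>
lemma modulus_le_of_dyadic_annuli:
  assumes r: "0 < r" "r < 1" and N: "0 < N" and \<delta>: "0 < \<delta>"
    and inner: "filled r \<subseteq> cball p \<delta>" and outer: "ball p (2 ^ N * \<delta>) \<subseteq> interior_domain"
  shows "modulus (ring_curves (Some ` shell {r<..<1})) \<le>
    ennreal (real N * (unit_ball_vol (real CARD('n)) * (2 / N) ^ CARD('n)))"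
proof -
  define \<alpha> where "\<alpha> k = 2 ^ k * \<delta>" for k :: nat
  define \<beta> where "\<beta> k = 2 ^ Suc k * \<delta>" for k :: nat
  \<comment> \<open>Annulus \<open>k\<close> has width \<open>2 ^ k * \<delta>\<close>, so with this
    height each crossing contributes exactly \<open>1 / N\<close>.\<close>
  define c where "c k = 1 / (N * (2 ^ k * \<delta>))" for k :: nat
  define A where "A k = {x. \<alpha> k < norm (x - p) \<and> norm (x - p) < \<beta> k}" for k
  define \<rho> where "\<rho> x = (\<Sum>k<N. ennreal (c k) * indicator (A k) x)" for x
  have c: "0 \<le> c k" "\<alpha> k \<le> \<beta> k" for k using \<delta> by (simp_all add: c_def \<alpha>_def \<beta>_def)
  have "open (A k)" for k
    unfolding A_def Collect_conj_eq by (intro open_Int open_Collect_less continuous_intros)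
  then have A[measurable]: "A k \<in> sets borel" for k by simp
  have disj: "A k \<inter> A l = {}" if "k < l" for k l
  proof -
    have "\<beta> k \<le> \<alpha> l"
      unfolding \<alpha>_def \<beta>_def using that \<delta> by (intro mult_right_mono power_increasing) auto
    then show ?thesis by (auto simp: A_def)
  qed
  \<comment> \<open>At most one summand is nonzero at a point, so the power passes through the
    sum.\<close>
  have pow: "\<rho> x ^ CARD('n) = (\<Sum>k<N. ennreal (c k ^ CARD('n)) * indicator (A k) x)" for x
  proof (cases "\<exists>k<N. x \<in> A k")
    case True
    then obtain k where k: "k < N" "x \<in> A k" by blast
    have "x \<notin> A l" if "l \<noteq> k" for l using disj[of k l] disj[of l k] that k by (cases "k < l") auto
    then have "(\<Sum>l<N. g l * indicator (A l) x) = g k" for g :: "nat \<Rightarrow> ennreal"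
      using k by (subst sum.remove[of _ k]) (auto intro!: sum.neutral)
    then show ?thesis unfolding \<rho>_def using c by (simp add: ennreal_power)
  next
    case False
    then show ?thesis unfolding \<rho>_def by (auto simp: sum.neutral indicator_def power_0_left)
  qed
  have sum1: "(\<Sum>k<N. c k * (\<beta> k - \<alpha> k)) = 1"
  proof -
    have "c k * (\<beta> k - \<alpha> k) = 1 / N" for k
      using \<delta> by (simp add: c_def \<alpha>_def \<beta>_def)
    then show ?thesis using N by simp
  qed
  have "\<rho> \<in> admissible (ring_curves (Some ` shell {r<..<1}))"
    unfolding admissible_def
  proof (intro CollectI conjI ballI impI)
    show "\<rho> \<in> borel_measurable borel" unfolding \<rho>_def by measurable
    have "\<rho> x < \<infinity>" for x
      unfolding \<rho>_def by (auto simp: less_top[symmetric] ennreal_mult_eq_top_iff indicator_def)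
    then show "AE x in lborel. \<rho> x < \<infinity>" by simp
    fix \<gamma> assume \<gamma>: "\<gamma> \<in> ring_curves (Some ` shell {r<..<1})" and rect: "rectifiable \<gamma>"
    have small: "norm (z - p) \<le> \<alpha> k" if "z \<in> filled r" for z k
    proof -
      have "norm (z - p) \<le> 1 * \<delta>" using inner that by (auto simp: dist_norm norm_minus_commute)
      also have "\<dots> \<le> \<alpha> k" unfolding \<alpha>_def using \<delta> by (intro mult_right_mono) auto
      finally show ?thesis .
    qed
    have large: "\<beta> k \<le> norm (z - p)" if "z \<notin> interior_domain" "k < N" for z k
    proof -
      have "\<beta> k \<le> 2 ^ N * \<delta>"
        unfolding \<beta>_def using that \<delta> by (intro mult_right_mono power_increasing) auto
      moreover have "2 ^ N * \<delta> \<le> norm (z - p)"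
        using outer that(1) by (auto simp: dist_norm norm_minus_commute not_less)
      ultimately show ?thesis by linarith
    qed
    have "ennreal (\<Sum>k<N. c k * (\<beta> k - \<alpha> k)) \<le> line_integral \<gamma> \<rho>"
      unfolding \<rho>_def A_def
    proof (rule line_integral_annuli_ge[OF rect])
      fix k assume "k < N"
      then show "norm (\<gamma> 0 - p) \<le> \<alpha> k \<and> \<beta> k \<le> norm (\<gamma> 1 - p) \<or>
          norm (\<gamma> 1 - p) \<le> \<alpha> k \<and> \<beta> k \<le> norm (\<gamma> 0 - p)"
        using ring_curves_shell_endpoints[OF r \<gamma>] small large by blast
    qed (use c in auto)
    then show "1 \<le> line_integral \<gamma> \<rho>" by (simp add: sum1)
  qed
  then have "modulus (ring_curves (Some ` shell {r<..<1})) \<le> (\<integral>\<^sup>+x. \<rho> x ^ CARD('n) \<partial>lborel)"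
    unfolding modulus_def by (rule INF_lower)
  also have "\<dots> = (\<Sum>k<N. ennreal (c k ^ CARD('n)) * emeasure lborel (A k))"
    unfolding pow by (subst nn_integral_sum) (auto simp: nn_integral_cmult_indicator)
  also have "\<dots> \<le> (\<Sum>k<N. ennreal (unit_ball_vol (real CARD('n)) * (2 / N) ^ CARD('n)))"
  proof (rule sum_mono)
    fix k
    \<comment> \<open>The volume of the whole outer ball suffices. Height times outer radius is
      \<open>2 / N\<close> for every \<open>k\<close>, which reflects the scale invariance of the
      integral of the \<open>n\<close>-th power.\<close>
    have "A k \<subseteq> cball p (\<beta> k)" by (auto simp: A_def dist_norm norm_minus_commute)
    then have "emeasure lborel (A k) \<le> emeasure lborel (cball p (\<beta> k))"
      by (intro emeasure_mono) auto
    also have "\<dots> = ennreal (unit_ball_vol (real CARD('n)) * \<beta> k ^ CARD('n))"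
      using \<delta> by (subst emeasure_cball) (auto simp: \<beta>_def)
    finally have "ennreal (c k ^ CARD('n)) * emeasure lborel (A k) \<le>
        ennreal (c k ^ CARD('n)) * ennreal (unit_ball_vol (real CARD('n)) * \<beta> k ^ CARD('n))"
      by (intro mult_left_mono) auto
    also have "\<dots> = ennreal (c k ^ CARD('n) * (unit_ball_vol (real CARD('n)) * \<beta> k ^ CARD('n)))"
      using c \<delta> by (intro ennreal_mult[symmetric]) (auto simp: \<beta>_def)
    also have "c k ^ CARD('n) * (unit_ball_vol (real CARD('n)) * \<beta> k ^ CARD('n)) =
        unit_ball_vol (real CARD('n)) * (c k * \<beta> k) ^ CARD('n)"
      by (simp add: power_mult_distrib)
    also have "c k * \<beta> k = 2 / N" using \<delta> by (simp add: c_def \<beta>_def)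
    finally show "ennreal (c k ^ CARD('n)) * emeasure lborel (A k) \<le>
        ennreal (unit_ball_vol (real CARD('n)) * (2 / N) ^ CARD('n))" .
  qed
  also have "\<dots> = ennreal (real N * (unit_ball_vol (real CARD('n)) * (2 / N) ^ CARD('n)))"
    using N by (simp add: ennreal_mult ennreal_of_nat_eq_real_of_nat)
  finally show ?thesis .
qed

section \<open>Cavitation and the limit of the ring moduli\<close>

lemma admits_cavitation_iff: "admits_cavitation f \<longleftrightarrow> (\<exists>x\<in>cavity. \<exists>y\<in>cavity. x \<noteq> y)"
  unfolding admits_cavitation_def
  using bounded_component_eq_cavity cavity_component compact_cavity connected_cavity
    compact_imp_bounded by blast

lemma ring_modulus_bounded_of_cavity:
  assumes "x \<in> cavity" "y \<in> cavity" "x \<noteq> y"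
  obtains L where "\<And>r. 0 < r \<Longrightarrow> r < 1 \<Longrightarrow> ring_modulus (Some ` shell {r<..<1}) \<le> ereal L"
proof (rule modulus_ge_of_cavity[OF assms])
  fix \<kappa> :: real
  assume \<kappa>: "0 < \<kappa>"
    "\<And>r. 0 < r \<Longrightarrow> r < 1 \<Longrightarrow> ennreal \<kappa> \<le> modulus (ring_curves (Some ` shell {r<..<1}))"
  have n: "CARD('n) \<ge> 2" using dim by simp
  have area: "0 \<le> sphere_area CARD('n)" by (simp add: sphere_area_def)
  define L where "L = (sphere_area CARD('n) / \<kappa>) powr (1 / (real CARD('n) - 1))"
  have "ring_modulus (Some ` shell {r<..<1}) \<le> ereal L" if r: "0 < r" "r < 1" for r
  proof -
    define M where "M = modulus (ring_curves (Some ` shell {r<..<1}))"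
    have \<kappa>M: "ennreal \<kappa> \<le> M" unfolding M_def by (rule \<kappa>(2)[OF r])
    then have "M \<noteq> 0" using \<kappa>(1) by auto
    show ?thesis
    proof (cases "M = \<infinity>")
      case True
      then show ?thesis by (simp add: ring_modulus_def M_def[symmetric] L_def)
    next
      case False
      then have "\<kappa> \<le> enn2real M"
        using \<kappa>M \<kappa>(1) by (metis enn2real_ennreal enn2real_mono infinity_ennreal_def less_imp_le top.not_eq_extremum)
      then have "sphere_area CARD('n) / enn2real M \<le> sphere_area CARD('n) / \<kappa>"
        using area \<kappa>(1) by (intro divide_left_mono) auto
      then have "(sphere_area CARD('n) / enn2real M) powr (1 / (real CARD('n) - 1)) \<le> L"
        unfolding L_def using area n by (intro powr_mono2) auto
      then show ?thesis
        using False \<open>M \<noteq> 0\<close> by (simp add: ring_modulus_def M_def[symmetric])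
    qed
  qed
  then show thesis by (rule that)
qed

text \<open>The unit ball volume in the sphere area cancels that in the upper bound for the modulus.
  What remains is \<open>n / 2 ^ n * N ^ (n - 1)\<close>, and the root of order \<open>n - 1\<close>
  makes the estimate linear in \<open>N\<close>.\<close>

lemma ring_modulus_ge_of_dyadic_annuli:
  assumes r: "0 < r" "r < 1" and N: "0 < N" and \<delta>: "0 < \<delta>"
    and inner: "filled r \<subseteq> cball p \<delta>" and outer: "ball p (2 ^ N * \<delta>) \<subseteq> interior_domain"
  shows "ereal (N * (CARD('n) / 2 ^ CARD('n)) powr (1 / (real CARD('n) - 1)))
    \<le> ring_modulus (Some ` shell {r<..<1})"
proof -
  define M where "M = modulus (ring_curves (Some ` shell {r<..<1}))"
  define v where "v = unit_ball_vol (real CARD('n))"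
  have v: "0 < v" by (simp add: v_def)
  obtain m where m: "CARD('n) = Suc m" "0 < m" using dim by (cases "CARD('n)") auto
  have M: "M \<le> ennreal (N * (v * (2 / N) ^ Suc m))"
    using modulus_le_of_dyadic_annuli[OF assms] unfolding M_def v_def m(1) .
  have "M \<noteq> \<infinity>" using M by (auto simp: top_unique)
  show ?thesis
  proof (cases "M = 0")
    case True
    then show ?thesis by (simp add: ring_modulus_def M_def[symmetric])
  next
    case False
    define x where "x = enn2real M"
    have x: "0 < x" using False \<open>M \<noteq> \<infinity>\<close> by (simp add: x_def enn2real_positive_iff less_top zero_less_iff_neq_zero)
    have "x \<le> N * (v * (2 / N) ^ Suc m)"
      unfolding x_def using M v by (intro enn2real_leI) auto
    then have "x * N ^ m \<le> v * 2 ^ Suc m"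
      using N by (simp add: power_divide field_simps)
    \<comment> \<open>The factor converts the upper bound for \<open>x\<close> into a lower bound
      for the sphere area divided by \<open>x\<close>.\<close>
    then have "x * N ^ m * (Suc m / (2 ^ Suc m * x)) \<le> v * 2 ^ Suc m * (Suc m / (2 ^ Suc m * x))"
      using x by (intro mult_right_mono) auto
    then have "Suc m / 2 ^ Suc m * N ^ m \<le> Suc m * v / x"
      using x by (simp add: mult_ac)
    then have "(Suc m / 2 ^ Suc m * N ^ m) powr (1 / m) \<le> (Suc m * v / x) powr (1 / m)"
      by (intro powr_mono2) auto
    also have "(Suc m / 2 ^ Suc m * N ^ m) powr (1 / m) = N * (Suc m / 2 ^ Suc m) powr (1 / m)"
    proof -
      have "real (N ^ m) powr (1 / m) = N"
        using N m by (simp add: powr_powr flip: powr_realpow)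
      moreover have "(Suc m / 2 ^ Suc m * N ^ m) powr (1 / m) =
          (Suc m / 2 ^ Suc m) powr (1 / m) * real (N ^ m) powr (1 / m)"
        by (rule powr_mult)
      ultimately show ?thesis by simp
    qed
    finally show ?thesis
      using False \<open>M \<noteq> \<infinity>\<close>
      by (simp add: ring_modulus_def M_def[symmetric] sphere_area_def m v_def x_def)
  qed
qed

lemma ring_modulus_tendsto_infinity_iff:
  "((\<lambda>r. ring_modulus (Some ` shell {r<..<1})) \<longlongrightarrow> \<infinity>) (at_right 0) \<longleftrightarrow>
     \<not> (\<exists>x\<in>cavity. \<exists>y\<in>cavity. x \<noteq> y)"
proof
  assume lim: "((\<lambda>r. ring_modulus (Some ` shell {r<..<1})) \<longlongrightarrow> \<infinity>) (at_right 0)"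
  have "False" if "x \<in> cavity" "y \<in> cavity" "x \<noteq> y" for x y
  proof (rule ring_modulus_bounded_of_cavity[OF that])
    fix L assume L: "\<And>r. 0 < r \<Longrightarrow> r < 1 \<Longrightarrow> ring_modulus (Some ` shell {r<..<1}) \<le> ereal L"
    have "\<forall>\<^sub>F r in at_right 0. ereal L < ring_modulus (Some ` shell {r<..<1})"
      using lim by (auto simp: tendsto_PInfty)
    moreover have "\<forall>\<^sub>F r in at_right 0. r \<in> {0<..<1::real}"
      by (rule eventually_at_right_real) simp
    ultimately have "\<forall>\<^sub>F r in at_right (0::real). False"
      by eventually_elim (use L in \<open>auto simp: not_le[symmetric]\<close>)
    then show False by (simp add: trivial_limit_at_right_real)
  qed
  then show "\<not> (\<exists>x\<in>cavity. \<exists>y\<in>cavity. x \<noteq> y)" by blast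
next
  assume "\<not> (\<exists>x\<in>cavity. \<exists>y\<in>cavity. x \<noteq> y)"
  then obtain p where p: "cavity = {p}" using cavity_ne by blast
  then obtain R where R: "0 < R" "ball p R \<subseteq> interior_domain"
    using open_interior_domain cavity_subset_interior_domain open_contains_ball by blast
  define q where "q = (CARD('n) / 2 ^ CARD('n)) powr (1 / (real CARD('n) - 1))"
  have q: "0 < q" by (simp add: q_def)
  show "((\<lambda>r. ring_modulus (Some ` shell {r<..<1})) \<longlongrightarrow> \<infinity>) (at_right 0)"
    unfolding tendsto_PInfty
  proof
    fix x :: real
    obtain N0 :: nat where "\<bar>x\<bar> / q < N0" using reals_Archimedean2 by blast
    define N where "N = Suc N0"
    have "\<bar>x\<bar> < N0 * q" using \<open>\<bar>x\<bar> / q < N0\<close> q by (simp add: pos_divide_less_eq)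
    also have "\<dots> \<le> N * q" using q by (simp add: N_def)
    finally have N: "0 < N" "x < N * q" by (simp_all add: N_def)
    \<comment> \<open>With this radius, \<open>N\<close> successive doublings lead from \<delta>
      exactly to \<open>R\<close>, so all annuli stay in the domain.\<close>
    define \<delta> where "\<delta> = R / 2 ^ N"
    have \<delta>: "0 < \<delta>" "2 ^ N * \<delta> = R" using R by (simp_all add: \<delta>_def)
    \<comment> \<open>Here the cavity being the single point \<open>p\<close> is decisive: some
      filled surface fits into the smallest ball.\<close>
    obtain r0 where r0: "0 < r0" "r0 < 1" "filled r0 \<subseteq> ball p \<delta>"
      using filled_shrink[of "ball p \<delta>"] p \<delta> by auto
    have "\<forall>\<^sub>F r in at_right 0. r \<in> {0<..<r0}"
      using r0(1) by (rule eventually_at_right_real)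
    then show "\<forall>\<^sub>F r in at_right 0. ereal x < ring_modulus (Some ` shell {r<..<1})"
    proof eventually_elim
      case (elim r)
      then have r: "0 < r" "r < 1" using r0 by auto
      have "filled r \<subseteq> cball p \<delta>"
        using filled_mono[of r r0] elim r0 ball_subset_cball[of p \<delta>] by auto
      from ring_modulus_ge_of_dyadic_annuli[OF r N(1) \<delta>(1) this]
      have "ereal (N * q) \<le> ring_modulus (Some ` shell {r<..<1})"
        using R \<delta> by (simp add: q_def)
      moreover have "ereal x < ereal (N * q)" using N by simp
      ultimately show ?case by (rule less_le_trans[rotated])
    qed
  qed
qed

end

theorem theorem3p1:
  fixes f :: "real^'n \<Rightarrow> real^'n"
  assumes "CARD('n) \<ge> 2"
    and "locally_quasiconformal_embedding f"
    and "orientation_preserving_on punctured_ball f"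
    and "nested_spheres f"
  shows "\<not> admits_cavitation f \<longleftrightarrow>
    ((\<lambda>r. ring_modulus (Some ` f ` spherical_ring r 1)) \<longlongrightarrow> \<infinity>) (at_right 0)"
proof -
  obtain g where g: "homeomorphism punctured_cball (f ` punctured_cball) f g"
    using assms(2) unfolding locally_quasiconformal_embedding_def by blast
  interpret nested_sphere_embedding_cart f
  proof (unfold_locales)
    show "2 \<le> DIM(real^'n)" using assms(1) by simp
    show "continuous_on punctured_cball f" using g by (rule homeomorphism_cont1)
    show "inj_on f punctured_cball" using homeomorphism_apply1[OF g] by (rule inj_on_inverseI)
    show "f ` sphere 0 r \<subseteq> inside (f ` sphere 0 s)" if "0 < r" "r < s" "s < 1" for r s
      using assms(4) that unfolding nested_spheres_def by blast
  qed
  have "f ` spherical_ring r 1 = shell {r<..<1}" for r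
    by (auto simp: shell_def spherical_ring_def)
  then show ?thesis
    by (simp add: admits_cavitation_iff ring_modulus_tendsto_infinity_iff)
qed

end
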